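(* Let $t\in[0,1)$ and let $\Theta$ be one of the two finite Blaschke products \[ \Theta(z)=\left(\frac{z-t}{1-tz}\right)^5 \quad\text{or}\quad \Theta(z)=\left(\frac{z-t}{1-tz}\right)^3\left(\frac{z-\sqrt{t}}{1-\sqrt{t}\,z}\right). \] Then $\Theta$ satisfies the pseudohyperbolic disk criterion. That is, with $n=\deg\Theta$ (so $n=5$, respectively $n=4$), there is a point $z_0\in\mathbb{D}$ such that $D_\rho\left(z_0,(\tfrac12)^{1/(n-1)}\right)\subseteq W(M_\Theta)$.
   Context: $\mathbb{D}$ is the open unit disk in $\mathbb{C}$. For an $n\times n$ complex matrix $A$, the numerical range is $W(A)=\{\langle Ax,x\rangle : x\in\mathbb{C}^n,\ \|x\|=1\}$. For $z_0\in\mathbb{D}$ and $r\in(0,1)$, the pseudohyperbolic disk is $D_\rho(z_0,r)=\{z\in\mathbb{D}: |\frac{z-z_0}{1-\overline{z_0}z}|<r\}$. For a finite Blaschke product $\Theta(z)=\prod_{j=1}^n\frac{z-a_j}{1-\overline{a_j}z}$ with zeros $a_1,\dots,a_n\in\mathbb{D}$ (listed with multiplicity), $\deg\Theta=n$ and $M_\Theta$ is the upper triangular $n\times n$ matrix with entries $(M_\Theta)_{ii}=a_i$, $(M_\Theta)_{ij}=0$ for $i>j$, and $(M_\Theta)_{ij}=\sqrt{1-|a_i|^2}\sqrt{1-|a_j|^2}\prod_{k=i+1}^{j-1}(-\overline{a_k})$ for $i<j$ (an empty product equals $1$). Here the zeros are listed in the order in which the factors of $\Theta$ are written: $t,t,t,t,t$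 in the first case and $t,t,t,\sqrt t$ in the second. *)

theory Defs
  imports Complex_Main "Jordan_Normal_Form.Matrix"
begin

text \<open>
  \<open>u \<bullet>c v\<close> is the inner product linear in the first argument, so \<open>(A *\<^sub>v x) \<bullet>c x\<close> is
  \<open>\<langle>Ax, x\<rangle>\<close>.
\<close>

definition vec_l2norm :: "complex vec \<Rightarrow> real" where
  "vec_l2norm x = sqrt (\<Sum>i<dim_vec x. (cmod (x $ i))\<^sup>2)"

definition numerical_range :: "complex mat \<Rightarrow> complex set" where
  "numerical_range A =
     {(A *\<^sub>v x) \<bullet>c x | x. x \<in> carrier_vec (dim_col A) \<and> vec_l2norm x = 1}"

definition unit_disk :: "complex set" where
  "unit_disk = {z. cmod z < 1}"

definition pseudohyperbolic_disk :: "complex \<Rightarrow> real \<Rightarrow> complex set" where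
  "pseudohyperbolic_disk z0 r =
     {z \<in> unit_disk. cmod ((z - z0) / (1 - cnj z0 * z)) < r}"

text \<open>
  \<open>as\<close> lists the zeros of the finite Blaschke product \<open>\<Theta>\<close> with multiplicity, in the order in
  which its factors are written. The list is kept as data because the matrix below depends on that
  order; the degree of \<open>\<Theta>\<close> is \<open>length as\<close>.
\<close>

definition finite_blaschke_product :: "(complex \<Rightarrow> complex) \<Rightarrow> complex list \<Rightarrow> bool" where
  "finite_blaschke_product \<Theta> as \<longleftrightarrow>
     set as \<subseteq> unit_disk \<and>
     (\<forall>z \<in> unit_disk. \<Theta> z = (\<Prod>j<length as. (z - as ! j) / (1 - cnj (as ! j) * z)))"

text \<open>The matrix \<open>M\<^sub>\<Theta>\<close>, with rows and columns indexed from 0.\<close>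

definition blaschke_mat :: "complex list \<Rightarrow> complex mat" where
  "blaschke_mat as = mat (length as) (length as) (\<lambda>(i, j).
     if i = j then as ! i
     else if i < j then
       complex_of_real (sqrt (1 - (cmod (as ! i))\<^sup>2)) *
       complex_of_real (sqrt (1 - (cmod (as ! j))\<^sup>2)) *
       (\<Prod>k = i + 1..<j. - cnj (as ! k))
     else 0)"

definition pseudohyperbolic_disk_criterion :: "complex list \<Rightarrow> bool" where
  "pseudohyperbolic_disk_criterion as \<longleftrightarrow>
     (\<exists>z0 \<in> unit_disk.
        pseudohyperbolic_disk z0 ((1 / 2) powr (1 / (real (length as) - 1)))
          \<subseteq> numerical_range (blaschke_mat as))"

end

(*
  Write B for the Blaschke product. If z and z' are distinct points of the unit circle with
  z B(z) = z' B(z'), then the chord [z, z'] meets the numerical range W. For real zeros and unimodular u the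
  pair z = u e^(ix), z' = u e^(-ix) has this property as soon as x plus the arguments of explicit
  complex numbers, one for each zero, sum to pi; the intermediate value theorem produces such an x
  below a given d when the sum at d is at least pi. So W reaches at least as far as cos d in
  direction u. By convexity (Toeplitz-Hausdorff) W contains a disk once its support
  function is dominated in this way. With the disk having ends 1 - 2 alpha^2 and 2 beta^2 - 1 on the
  real axis and Re u = 1 - 2 v, d is given by
  sin^2 (d/2) = (1 - v) alpha^2 + v beta^2, and the condition on the arguments is implied by its
  cases v = 0 and v = 1, where it becomes a polynomial inequality in one variable for suitable rational
  alpha and beta.
*)
theory Submission
  imports Defs "HOL-Analysis.Analysis"
begin

text \<open>The chords come from a unitary dilation: for n zeros, the n + 1 points of the circle
  where z B(z) takes a given unimodular value are the eigenvalues of a unitary dilation of the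
  matrix to dimension n + 1. The plane spanned by two eigenvectors meets the original n-dimensional
  space, and a vector in the intersection has its Rayleigh quotient on the chord. The proof writes
  such a vector down explicitly.

  The obstacle is that the best chord angle in direction u solves an equation between arctangents,
  to be controlled for all u and t at once. After a Cayley transform of the zeros the relevant
  cotangents, up to the factor 1 / sin d, are affine in v and S^2 with S = sin (d/2). A sufficient
  condition of the form (affine in v) <= Q S^2 + K S with K >= 0 then follows from its ends v = 0
  and v = 1, because the square root is concave.

  Little may be lost on the way: for t = 0 the matrix is a nilpotent Jordan block, and W is the disk
  about 0 of radius cos (pi / (n + 1)), that is 0.866 and 0.809, against the required radii 0.841
  and 0.794.\<close>

section \<open>The numerical range and the Toeplitz-Hausdorff theorem\<close>

lemma scalar_prod_self_eq_norm:
  "x \<bullet>c x = complex_of_real ((vec_l2norm x)\<^sup>2)"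
  by (simp add: vec_l2norm_def scalar_prod_def sum_nonneg complex_norm_square[symmetric] lessThan_atLeast0 del: of_real_power)

text \<open>Both sides of the equation are homogeneous of the same degree in \<open>x\<close>, so
  vectors can be used without normalising them.\<close>

lemma numerical_rangeI:
  assumes A: "A \<in> carrier_mat n n" and x: "x \<in> carrier_vec n" and "x \<noteq> 0\<^sub>v n"
    and eq: "(A *\<^sub>v x) \<bullet>c x = z * (x \<bullet>c x)"
  shows "z \<in> numerical_range A"
proof -
  define r where "r = vec_l2norm x"
  have r0: "r \<noteq> 0"
    using assms(3) conjugate_square_eq_0_vec[OF x] scalar_prod_self_eq_norm[of x]
    by (auto simp: r_def)
  have rpos: "r > 0" using r0 unfolding r_def vec_l2norm_def
    by (metis less_eq_real_def real_sqrt_ge_zero sum_nonneg zero_le_power2)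
  define y where "y = complex_of_real (1 / r) \<cdot>\<^sub>v x"
  have y: "y \<in> carrier_vec n" using x by (simp add: y_def)
  have yy: "(B *\<^sub>v y) \<bullet>c y = complex_of_real (1 / r\<^sup>2) * ((B *\<^sub>v x) \<bullet>c x)"
    if B: "B \<in> carrier_mat n n" for B
  proof -
    have "B *\<^sub>v y = complex_of_real (1 / r) \<cdot>\<^sub>v (B *\<^sub>v x)"
      unfolding y_def using B x by (simp add: mult_mat_vec)
    moreover have "conjugate y = complex_of_real (1 / r) \<cdot>\<^sub>v conjugate x"
      unfolding y_def by (simp add: conjugate_smult_vec)
    ultimately show ?thesis using B x
      by (simp add: power2_eq_square)
  qed
  have "y \<bullet>c y = 1"
    using yy[of "1\<^sub>m n"] x y r0 scalar_prod_self_eq_norm[of x]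
    by (simp add: r_def)
  hence "complex_of_real ((vec_l2norm y)\<^sup>2) = 1"
    using scalar_prod_self_eq_norm by metis
  hence "(vec_l2norm y)\<^sup>2 = 1" using of_real_eq_1_iff by blast
  moreover have "vec_l2norm y \<ge> 0" by (simp add: vec_l2norm_def sum_nonneg)
  ultimately have "vec_l2norm y = 1" by (simp add: power2_eq_1_iff)
  moreover have "(A *\<^sub>v y) \<bullet>c y = z"
    using yy[OF A] eq scalar_prod_self_eq_norm[of x] r0 by (simp add: r_def)
  ultimately show ?thesis
    using A y unfolding numerical_range_def by auto
qed

lemma quadratic_form_combination:
  fixes A :: "complex mat"
  assumes A: "A \<in> carrier_mat n n" and x: "x \<in> carrier_vec n" and y: "y \<in> carrier_vec n"
  shows "(A *\<^sub>v (\<alpha> \<cdot>\<^sub>v x + \<beta> \<cdot>\<^sub>v y)) \<bullet>c (\<alpha> \<cdot>\<^sub>v x + \<beta> \<cdot>\<^sub>v y) =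
    \<alpha> * cnj \<alpha> * ((A *\<^sub>v x) \<bullet>c x) + \<beta> * cnj \<beta> * ((A *\<^sub>v y) \<bullet>c y)
    + \<beta> * cnj \<alpha> * ((A *\<^sub>v y) \<bullet>c x) + \<alpha> * cnj \<beta> * ((A *\<^sub>v x) \<bullet>c y)"
proof -
  have "A *\<^sub>v (\<alpha> \<cdot>\<^sub>v x + \<beta> \<cdot>\<^sub>v y) = \<alpha> \<cdot>\<^sub>v (A *\<^sub>v x) + \<beta> \<cdot>\<^sub>v (A *\<^sub>v y)"
    using A x y by (simp add: mult_add_distrib_mat_vec mult_mat_vec)
  moreover have "conjugate (\<alpha> \<cdot>\<^sub>v x + \<beta> \<cdot>\<^sub>v y) = cnj \<alpha> \<cdot>\<^sub>v conjugate x + cnj \<beta> \<cdot>\<^sub>v conjugate y"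
    using x y by (simp add: conjugate_smult_vec conjugate_add_vec[of _ n])
  ultimately show ?thesis
    using A x y
    by (simp add: scalar_prod_add_distrib[of _ n] add_scalar_prod_distrib[of _ n] algebra_simps)
qed

text \<open>The imaginary part equals that of \<open>c * (l - cnj k)\<close>, so \<open>c\<close> is
  taken as the phase that turns \<open>l - cnj k\<close> into its modulus. This is the phase freedom
  that makes the cross term real in the convexity proof.\<close>

lemma exists_unit_rotation_real:
  fixes k l :: complex
  obtains c where "cmod c = 1" "Im (cnj c * k + c * l) = 0"
proof (cases "l = cnj k")
  case True
  show ?thesis by (rule that[of 1]) (auto simp: True)
next
  case False
  define m where "m = l - cnj k"
  have m: "m \<noteq> 0" using False by (simp add: m_def)
  define c where "c = cnj m / complex_of_real (cmod m)"
  have "cmod c = 1" using m by (simp add: c_def norm_divide)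
  moreover have "Im (cnj c * k + c * l) = Im (c * m)"
    by (simp add: m_def algebra_simps)
  moreover have "c * m = complex_of_real (cmod m)"
    using m by (simp add: c_def complex_norm_square[symmetric] power2_eq_square mult.commute[of "cnj m" m])
  ultimately show ?thesis using that by simp
qed

text \<open>An affine change of the matrix moves \<open>p\<close> to 0 and \<open>q\<close> to 1.
  Once a phase makes the cross term real, the Rayleigh quotient along a path from a multiple of
  \<open>x\<close> to \<open>y\<close> is a real continuous function running from 0 to 1, and it
  takes the value \<open>v\<close> on the way.\<close>

theorem convex_numerical_range:
  assumes A: "A \<in> carrier_mat n n"
  shows "convex (numerical_range A)"
proof (rule convexI)
  fix p q :: complex and u v :: real
  assume p: "p \<in> numerical_range A" and q: "q \<in> numerical_range A"
    and uv: "0 \<le> u" "0 \<le> v" "u + v = 1"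
  obtain x where x: "x \<in> carrier_vec n" "vec_l2norm x = 1" and px: "p = (A *\<^sub>v x) \<bullet>c x"
    using p A unfolding numerical_range_def by auto
  obtain y where y: "y \<in> carrier_vec n" "vec_l2norm y = 1" and qy: "q = (A *\<^sub>v y) \<bullet>c y"
    using q A unfolding numerical_range_def by auto
  have xx: "x \<bullet>c x = 1" and yy: "y \<bullet>c y = 1"
    using x y by (simp_all add: scalar_prod_self_eq_norm)
  show "u *\<^sub>R p + v *\<^sub>R q \<in> numerical_range A"
  proof (cases "p = q")
    case True
    thus ?thesis using uv p by (metis scaleR_left_distrib scaleR_one)
  next
    case False
    \<comment> \<open>\<open>k\<close> and \<open>l\<close> are the cross terms of the form of (A -
      p) / (q - p), which has the value 0 at \<open>x\<close> and 1 at \<open>y\<close>.\<close>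
    define k where "k = ((A *\<^sub>v y) \<bullet>c x - p * (y \<bullet>c x)) / (q - p)"
    define l where "l = ((A *\<^sub>v x) \<bullet>c y - p * (x \<bullet>c y)) / (q - p)"
    obtain c where c: "cmod c = 1" "Im (cnj c * k + c * l) = 0"
      by (rule exists_unit_rotation_real)
    define \<kappa> where "\<kappa> = Re (cnj c * k + c * l)"
    have \<kappa>: "cnj c * k + c * l = complex_of_real \<kappa>"
      using c(2) by (simp add: \<kappa>_def complex_eq_iff)
    have cc: "c * cnj c = 1" using c(1) by (simp flip: complex_norm_square)
    define z where "z s = (complex_of_real (1 - s) * c) \<cdot>\<^sub>v x + complex_of_real s \<cdot>\<^sub>v y" for s :: real
    have zc: "z s \<in> carrier_vec n" for s using x y by (simp add: z_def)
    define N where "N s = (1 - s)\<^sup>2 + s\<^sup>2 + s * (1 - s) * Re (cnj c * (y \<bullet>c x) + c * (x \<bullet>c y))" for s :: real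
    have N_eq': "z s \<bullet>c z s = complex_of_real ((1 - s)\<^sup>2 + s\<^sup>2) +
        complex_of_real (s * (1 - s)) * (cnj c * (y \<bullet>c x) + c * (x \<bullet>c y))" for s
    proof -
      have "z s \<bullet>c z s = (1\<^sub>m n *\<^sub>v z s) \<bullet>c z s" using zc by simp
      also have "\<dots> = complex_of_real ((1-s)\<^sup>2) * (c * cnj c) + complex_of_real (s\<^sup>2)
         + complex_of_real (s * (1 - s)) * (cnj c * (y \<bullet>c x) + c * (x \<bullet>c y))"
        unfolding z_def
        by (subst quadratic_form_combination[OF one_carrier_mat x(1) y(1)])
          (use x y xx yy in \<open>simp add: algebra_simps power2_eq_square\<close>)
      finally show ?thesis using cc by simp
    qed
    have N_eq: "z s \<bullet>c z s = complex_of_real (N s)" for s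
    proof -
      have "Re (z s \<bullet>c z s) = N s" unfolding N_eq' by (simp add: N_def)
      thus ?thesis using scalar_prod_self_eq_norm[of "z s"] by (metis Re_complex_of_real)
    qed
    have E_eq: "(A *\<^sub>v z s) \<bullet>c z s =
        p * (z s \<bullet>c z s) + (q - p) * complex_of_real (s\<^sup>2 + s * (1 - s) * \<kappa>)" for s
    proof -
      have "(A *\<^sub>v z s) \<bullet>c z s = complex_of_real ((1-s)\<^sup>2) * (c * cnj c) * p + complex_of_real (s\<^sup>2) * q
         + complex_of_real (s * (1 - s)) * (cnj c * ((A *\<^sub>v y) \<bullet>c x) + c * ((A *\<^sub>v x) \<bullet>c y))"
        unfolding z_def
        by (subst quadratic_form_combination[OF A x(1) y(1)])
          (simp add: algebra_simps power2_eq_square px qy)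
      moreover have "(A *\<^sub>v y) \<bullet>c x = (q - p) * k + p * (y \<bullet>c x)"
        using False by (simp add: k_def)
      moreover have "(A *\<^sub>v x) \<bullet>c y = (q - p) * l + p * (x \<bullet>c y)"
        using False by (simp add: l_def)
      ultimately show ?thesis unfolding N_eq' cc of_real_add of_real_mult[of _ \<kappa>] \<kappa>[symmetric]
        by (simp add: algebra_simps)
    qed
    have Npos: "N s > 0" and znz: "z s \<noteq> 0\<^sub>v n" if "s \<in> {0..1}" for s
    proof -
      show znz: "z s \<noteq> 0\<^sub>v n"
      proof
        \<comment> \<open>If the combination vanished, \<open>x\<close> and \<open>y\<close> would
          be parallel. Comparing norms gives equal weights, and comparing the forms then gives
          \<open>p = q\<close>.\<close>
        assume "z s = 0\<^sub>v n"
        hence "complex_of_real (1 - s) * c * vec_index x i = - (complex_of_real s * vec_index y i)" if "i < n" for i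
          using that x y unfolding z_def
          by (metis (no_types, lifting) add_eq_0_iff2 carrier_vecD index_add_vec(1) index_smult_vec(1) index_smult_vec(2) index_zero_vec(1))
        hence e: "(complex_of_real (1 - s) * c) \<cdot>\<^sub>v x = (- complex_of_real s) \<cdot>\<^sub>v y"
          using x y by (intro eq_vecI) auto
        have form: "(B *\<^sub>v (\<alpha> \<cdot>\<^sub>v w)) \<bullet>c (\<alpha> \<cdot>\<^sub>v w) = (\<alpha> * cnj \<alpha>) * ((B *\<^sub>v w) \<bullet>c w)"
          if "B \<in> carrier_mat n n" "w \<in> carrier_vec n" for B w and \<alpha> :: complex
          using that by (simp add: mult_mat_vec conjugate_smult_vec algebra_simps)
        have "complex_of_real ((1 - s)\<^sup>2) * (c * cnj c) * p = complex_of_real (s\<^sup>2) * q"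
          using arg_cong[OF e, of "\<lambda>w. (A *\<^sub>v w) \<bullet>c w"] form[OF A x(1)] form[OF A y(1)]
          by (simp add: px qy power2_eq_square algebra_simps)
        moreover have "complex_of_real ((1 - s)\<^sup>2) * (c * cnj c) = complex_of_real (s\<^sup>2)"
        proof -
          have "complex_of_real (1 - s) * c * cnj (complex_of_real (1 - s) * c) * (x \<bullet>c x) =
              - complex_of_real s * cnj (- complex_of_real s) * (y \<bullet>c y)"
            using arg_cong[OF e, of "\<lambda>w. (1\<^sub>m n *\<^sub>v w) \<bullet>c w"]
            unfolding form[OF one_carrier_mat x(1)] form[OF one_carrier_mat y(1)]
            using x y by simp
          thus ?thesis by (simp add: xx yy power2_eq_square algebra_simps)
        qed
        ultimately have "complex_of_real (s\<^sup>2) * (p - q) = 0" "(1 - s)\<^sup>2 = s\<^sup>2"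
          unfolding cc by (simp_all add: algebra_simps flip: of_real_power of_real_diff)
        thus False using False by auto
      qed
      have "z s \<bullet>c z s \<noteq> 0" using conjugate_square_eq_0_vec[OF zc] znz by blast
      hence "N s \<noteq> 0" using N_eq[of s] by (metis of_real_0)
      moreover have "N s \<ge> 0"
        using N_eq[of s] scalar_prod_self_eq_norm[of "z s"] by (metis of_real_eq_iff zero_le_power2)
      ultimately show "N s > 0" by simp
    qed
    define f where "f s = (s\<^sup>2 + s * (1 - s) * \<kappa>) / N s" for s
    have "continuous_on {0..1} f"
      unfolding f_def N_def
      by (intro continuous_intros) (use Npos in \<open>auto simp: N_def less_le\<close>)
    moreover have "f 0 = 0" "f 1 = 1" by (simp_all add: f_def N_def)
    ultimately obtain s where s: "s \<in> {0..1}" "f s = v"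
      using IVT'[of f 0 v 1] uv by auto
    have "s\<^sup>2 + s * (1 - s) * \<kappa> = v * N s"
      using s Npos[OF s(1)] by (simp add: f_def field_simps)
    hence "(A *\<^sub>v z s) \<bullet>c z s = (p + (q - p) * complex_of_real v) * (z s \<bullet>c z s)"
      unfolding E_eq N_eq by (simp add: algebra_simps)
    hence "p + (q - p) * complex_of_real v \<in> numerical_range A"
      by (rule numerical_rangeI[OF A zc znz[OF s(1)]])
    moreover have "u *\<^sub>R p + v *\<^sub>R q = p + (q - p) * complex_of_real v"
    proof -
      have "u = 1 - v" using uv by simp
      show ?thesis unfolding \<open>u = 1 - v\<close> by (simp add: scaleR_conv_of_real algebra_simps)
    qed
    ultimately show ?thesis by simp
  qed
qed

section \<open>Blaschke products, the Takenaka-Malmquist basis and chords that meet the numerical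
  range\<close>

text \<open>The number of zeros is separate from their enumeration, so that the partial products
  entering the orthonormal basis are \<open>blaschke a j\<close> for the same
  \<open>a\<close>.\<close>

definition blaschke :: "(nat \<Rightarrow> complex) \<Rightarrow> nat \<Rightarrow> complex \<Rightarrow> complex" where
  "blaschke a n z = (\<Prod>k<n. (z - a k) / (1 - cnj (a k) * z))"

text \<open>The Takenaka--Malmquist orthonormal basis of the model space of the Blaschke product.\<close>

definition takenaka :: "(nat \<Rightarrow> complex) \<Rightarrow> nat \<Rightarrow> complex \<Rightarrow> complex" where
  "takenaka a j z = complex_of_real (sqrt (1 - (cmod (a j))\<^sup>2)) / (1 - cnj (a j) * z) * blaschke a j z"

lemma blaschke_denominator_nonzero:
  assumes "cmod a < 1" "cmod z = 1"
  shows "1 - cnj a * z \<noteq> 0"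
proof
  assume "1 - cnj a * z = 0"
  hence "cmod (cnj a * z) = 1" by simp
  thus False using assms by (simp add: norm_mult)
qed

lemma sqrt_one_minus_square:
  assumes "cmod a < 1"
  shows "complex_of_real (sqrt (1 - (cmod a)\<^sup>2)) * complex_of_real (sqrt (1 - (cmod a)\<^sup>2)) = 1 - a * cnj a"
proof -
  have "(cmod a)\<^sup>2 \<le> 1" using assms by (simp add: power_le_one)
  thus ?thesis by (simp flip: of_real_mult complex_norm_square)
qed

text \<open>The sum is the reproducing kernel of the model space. Each summand times
  \<open>1 - z * cnj w\<close> is the difference of two consecutive products of Blaschke values, and
  the sum telescopes.\<close>

lemma takenaka_christoffel_darboux:
  assumes "\<And>k. k < n \<Longrightarrow> cmod (a k) < 1" "cmod z = 1" "cmod w = 1"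
  shows "(1 - z * cnj w) * (\<Sum>j<n. takenaka a j z * cnj (takenaka a j w)) =
    1 - blaschke a n z * cnj (blaschke a n w)"
  using assms(1)
proof (induction n)
  case (Suc n)
  let ?a = "a n" and ?B = "blaschke a n z * cnj (blaschke a n w)"
  have z: "1 - cnj ?a * z \<noteq> 0" and w: "1 - ?a * cnj w \<noteq> 0"
    using blaschke_denominator_nonzero[of ?a z] blaschke_denominator_nonzero[of "cnj ?a" "cnj w"]
      Suc.prems[of n] assms by auto
  have "takenaka a n z * cnj (takenaka a n w) =
      (1 - ?a * cnj ?a) / ((1 - cnj ?a * z) * (1 - ?a * cnj w)) * ?B"
    unfolding takenaka_def sqrt_one_minus_square[OF Suc.prems[OF lessI], symmetric]
    by simp
  moreover have "blaschke a (Suc n) z * cnj (blaschke a (Suc n) w) =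
      (z - ?a) * (cnj w - cnj ?a) / ((1 - cnj ?a * z) * (1 - ?a * cnj w)) * ?B"
    by (simp add: blaschke_def)
  moreover have "(1 - z * cnj w) * ((1 - ?a * cnj ?a) / ((1 - cnj ?a * z) * (1 - ?a * cnj w))) =
      1 - (z - ?a) * (cnj w - cnj ?a) / ((1 - cnj ?a * z) * (1 - ?a * cnj w))"
  proof -
    have "(1 - z * cnj w) * (1 - ?a * cnj ?a) + (z - ?a) * (cnj w - cnj ?a) = (1 - cnj ?a * z) * (1 - ?a * cnj w)"
      by (simp add: algebra_simps)
    thus ?thesis
      using z w by (metis (no_types, lifting) add_diff_cancel_right' diff_divide_distrib divide_self
          mult_eq_0_iff times_divide_eq_right)
  qed
  ultimately have "(1 - z * cnj w) * (takenaka a n z * cnj (takenaka a n w)) =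
      (1 - (z - ?a) * (cnj w - cnj ?a) / ((1 - cnj ?a * z) * (1 - ?a * cnj w))) * ?B"
    and "blaschke a (Suc n) z * cnj (blaschke a (Suc n) w) =
      (z - ?a) * (cnj w - cnj ?a) / ((1 - cnj ?a * z) * (1 - ?a * cnj w)) * ?B"
    by (simp_all only: mult.assoc[symmetric])
  hence "(1 - z * cnj w) * (takenaka a n z * cnj (takenaka a n w)) =
      ?B - blaschke a (Suc n) z * cnj (blaschke a (Suc n) w)"
    by (simp only: left_diff_distrib mult_1)
  thus ?case
    using Suc by (simp add: distrib_left)
qed (simp add: blaschke_def)

text \<open>Multiplication by \<open>z\<close> takes a basis function out of the model space only by
  a constant multiple of the full Blaschke product. The matrix entries are the coefficients of the
  part that stays inside.\<close>

lemma takenaka_row_sum: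
  assumes "\<And>k. k < m \<Longrightarrow> cmod (a k) < 1" "cmod z = 1" "i < m"
  shows "a i * takenaka a i z + (\<Sum>j\<in>{i<..<m}. complex_of_real (sqrt (1 - (cmod (a i))\<^sup>2)) *
        complex_of_real (sqrt (1 - (cmod (a j))\<^sup>2)) * (\<Prod>k = i + 1..<j. - cnj (a k)) * takenaka a j z) =
    z * takenaka a i z - blaschke a m z *
        (complex_of_real (sqrt (1 - (cmod (a i))\<^sup>2)) * (\<Prod>k = i + 1..<m. - cnj (a k)))"
  using assms(3,1)
proof (induction m rule: less_induct)
  case (less m')
  then obtain m where m': "m' = Suc m" by (cases m') auto
  let ?s = "\<lambda>j. complex_of_real (sqrt (1 - (cmod (a j))\<^sup>2))"
  let ?a = "a m" and ?P = "\<Prod>k = i + 1..<m. - cnj (a k)"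
  have nz: "1 - cnj (a k) * z \<noteq> 0" if "k < m'" for k
    using blaschke_denominator_nonzero[of "a k" z] less.prems that assms by auto
  show ?case
  proof (cases "i = m")
    case True
    have "(z - ?a) * takenaka a m z = blaschke a m' z * ?s m"
      using nz[of m] m' by (simp add: takenaka_def blaschke_def field_simps)
    moreover have "{m<..<m'} = {}" using m' by auto
    ultimately show ?thesis using True m' by (simp add: algebra_simps)
  next
    case False
    hence im: "i < m" using less.prems m' by simp
    have "{i<..<m'} = insert m {i<..<m}" using m' im by auto
    moreover have "{i + 1..<m'} = insert m {i + 1..<m}" using m' im by auto
    \<comment> \<open>The new column splits into multiples of the old and the new partial product:
      the first cancels the remainder of the shorter sum, the second becomes the new
      remainder.\<close>
    moreover have "?s i * ?s m * ?P * takenaka a m z =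
        ?s i * ?P * blaschke a m z + ?s i * ?P * cnj ?a * blaschke a m' z"
    proof -
      have "?s m * takenaka a m z = (1 - ?a * cnj ?a) / (1 - cnj ?a * z) * blaschke a m z"
        unfolding sqrt_one_minus_square[OF less.prems(2)[of m, unfolded m', OF lessI], symmetric]
          takenaka_def by simp
      also have "(1 - ?a * cnj ?a) / (1 - cnj ?a * z) = 1 + cnj ?a * ((z - ?a) / (1 - cnj ?a * z))"
        using nz[of m] m' by (simp add: field_simps)
      also have "\<dots> * blaschke a m z = blaschke a m z +
          cnj ?a * (blaschke a m z * ((z - ?a) / (1 - cnj ?a * z)))"
        by (rule distrib_right[of 1 _ "blaschke a m z", THEN trans]) (simp only: mult_1 mult.commute mult.left_commute)
      also have "blaschke a m z * ((z - ?a) / (1 - cnj ?a * z)) = blaschke a m' z"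
        by (simp add: m' blaschke_def)
      finally have "?s i * ?P * (?s m * takenaka a m z) = ?s i * ?P * (blaschke a m z + cnj ?a * blaschke a m' z)"
        by (rule arg_cong)
      thus ?thesis by (simp only: distrib_left mult.assoc mult.left_commute)
    qed
    moreover have "a i * takenaka a i z + (\<Sum>j\<in>{i<..<m}. ?s i * ?s j *
        (\<Prod>k = i + 1..<j. - cnj (a k)) * takenaka a j z) =
        z * takenaka a i z - blaschke a m z * (?s i * ?P)"
      using less.IH[of m] im less.prems m' by simp
    ultimately show ?thesis
      by (simp add: algebra_simps)
  qed
qed

lemma blaschke_mat_carrier: "blaschke_mat as \<in> carrier_mat (length as) (length as)"
  by (simp add: blaschke_mat_def)

lemma blaschke_mat_mult_takenaka:
  assumes "set as \<subseteq> unit_disk" "cmod z = 1" "i < length as"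
  defines "a \<equiv> (!) as" and "n \<equiv> length as"
  shows "(\<Sum>j<n. blaschke_mat as $$ (i, j) * takenaka a j z) =
    z * takenaka a i z - blaschke a n z *
      (complex_of_real (sqrt (1 - (cmod (a i))\<^sup>2)) * (\<Prod>k = i + 1..<n. - cnj (a k)))"
proof -
  have lt: "cmod (a k) < 1" if "k < n" for k
    using subsetD[OF assms(1) nth_mem[of k as]] that by (simp add: a_def n_def unit_disk_def)
  have split: "{..<n} = {..<i} \<union> insert i {i<..<n}" using assms(3) by (auto simp: n_def)
  have "(\<Sum>j<n. f j) = (\<Sum>j<i. f j) + (f i + (\<Sum>j\<in>{i<..<n}. f j))" for f :: "nat \<Rightarrow> complex"
    unfolding split by (subst sum.union_disjoint) auto
  hence "(\<Sum>j<n. blaschke_mat as $$ (i, j) * takenaka a j z) =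
      (\<Sum>j<i. blaschke_mat as $$ (i, j) * takenaka a j z) + (blaschke_mat as $$ (i, i) * takenaka a i z
      + (\<Sum>j\<in>{i<..<n}. blaschke_mat as $$ (i, j) * takenaka a j z))" .
  also have "(\<Sum>j<i. blaschke_mat as $$ (i, j) * takenaka a j z) = 0"
    using assms(3) by (intro sum.neutral) (auto simp: blaschke_mat_def)
  also have "blaschke_mat as $$ (i, i) = a i"
    using assms(3) by (simp add: blaschke_mat_def a_def)
  also have "(\<Sum>j\<in>{i<..<n}. blaschke_mat as $$ (i, j) * takenaka a j z) =
      (\<Sum>j\<in>{i<..<n}. complex_of_real (sqrt (1 - (cmod (a i))\<^sup>2)) *
        complex_of_real (sqrt (1 - (cmod (a j))\<^sup>2)) * (\<Prod>k = i + 1..<j. - cnj (a k)) * takenaka a j z)"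
    using assms(3) by (intro sum.cong) (auto simp: blaschke_mat_def a_def n_def)
  finally show ?thesis
    using takenaka_row_sum[of n a z i] lt assms(2,3) by (simp add: n_def)
qed

text \<open>
  The vectors of values of the basis at \<open>z\<^sub>1\<close> and \<open>z\<^sub>2\<close> are eigenvectors of \<open>M\<close> up to multiples
  of one fixed vector, which cancel in their difference, weighted by \<open>z\<^sub>1\<close> and \<open>z\<^sub>2\<close>.
\<close>

lemma numerical_range_meets_chord:
  fixes as :: "complex list"
  assumes as: "set as \<subseteq> unit_disk" and "cmod z1 = 1" "cmod z2 = 1" "z1 \<noteq> z2"
    and eq: "z1 * blaschke ((!) as) (length as) z1 = z2 * blaschke ((!) as) (length as) z2"
  shows "closed_segment z1 z2 \<inter> numerical_range (blaschke_mat as) \<noteq> {}"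
proof -
  define a where "a = (!) as"
  define n where "n = length as"
  define B where "B = blaschke a n"
  define T where "T = takenaka a"
  define M where "M = blaschke_mat as"
  have M: "M \<in> carrier_mat n n" using blaschke_mat_carrier by (simp add: M_def n_def)
  have lt: "cmod (a k) < 1" if "k < n" for k
    using subsetD[OF as nth_mem[of k as]] that by (simp add: a_def n_def unit_disk_def)
  have un: "z1 * cnj z1 = 1" "z2 * cnj z2 = 1"
    using assms by (simp_all flip: complex_norm_square)
  define K where "K z w = (\<Sum>j<n. T j z * cnj (T j w))" for z w
  have CD: "(1 - z * cnj w) * K z w = 1 - B z * cnj (B w)" if "cmod z = 1" "cmod w = 1" for z w
    unfolding K_def T_def B_def using that lt by (intro takenaka_christoffel_darboux) auto
  \<comment> \<open>For equal arguments on the circle the factor \<open>1 - z * cnj w\<close>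
    vanishes, so the kernel identity says that \<open>B\<close> is unimodular.\<close>
  have B1: "B z1 * cnj (B z1) = 1" "B z2 * cnj (B z2) = 1"
    using CD[of z1 z1] CD[of z2 z2] assms un by simp_all
  have eq: "z1 * B z1 = z2 * B z2" using eq by (simp add: a_def n_def B_def)
  have BB: "B z1 * cnj (B z2) = cnj z1 * z2"
  proof -
    have "B z1 * cnj (B z2) = cnj z1 * (z1 * B z1) * cnj (B z2)" using un by (simp add: algebra_simps)
    also have "\<dots> = cnj z1 * z2 * (B z2 * cnj (B z2))" unfolding eq by (simp add: algebra_simps)
    finally show ?thesis using B1 by simp
  qed
  \<comment> \<open>The hypothesis fixes the kernel off the diagonal. The cross terms of the norm
    and of the form therefore merge with the diagonal ones, and the Rayleigh quotient becomes a mean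
    of \<open>z1\<close> and \<open>z2\<close> with weights proportional to \<open>k z + 1\<close>,
    the squared norm of the eigenvector in the dilation.\<close>
  have K12: "z1 * cnj z2 * K z1 z2 = -1"
  proof -
    have w: "(z1 * cnj z2) * (cnj z1 * z2) = 1" using un by (simp add: mult_ac) (metis mult.assoc mult.commute mult_1)
    have "(1 - z1 * cnj z2) * (z1 * cnj z2 * K z1 z2) = (z1 * cnj z2) * ((1 - z1 * cnj z2) * K z1 z2)"
      by (rule mult.left_commute)
    also have "\<dots> = (z1 * cnj z2) * (1 - cnj z1 * z2)"
      unfolding CD[OF assms(2,3)] BB ..
    also have "\<dots> = (1 - z1 * cnj z2) * (-1)" using w by (simp add: algebra_simps)
    finally have "z1 * cnj z2 * K z1 z2 = -1 \<or> 1 - z1 * cnj z2 = 0"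
      using mult_left_cancel by blast
    moreover have "1 - z1 * cnj z2 \<noteq> 0"
    proof
      assume "1 - z1 * cnj z2 = 0"
      hence "z1 * (z2 * cnj z2) = z2" by (simp add: mult_ac)
      thus False using un assms by simp
    qed
    ultimately show ?thesis by blast
  qed
  have K21: "z2 * cnj z1 * K z2 z1 = -1"
  proof -
    have "cnj (z1 * cnj z2 * K z1 z2) = z2 * cnj z1 * K z2 z1" by (simp add: K_def mult_ac)
    thus ?thesis unfolding K12 by simp
  qed
  define k where "k z = (\<Sum>j<n. (cmod (T j z))\<^sup>2)" for z
  have k: "K z z = complex_of_real (k z)" for z by (simp add: K_def k_def complex_norm_square del: of_real_power)
  have k0: "k z \<ge> 0" for z by (simp add: k_def sum_nonneg)
  define x where "x = Matrix.vec n (\<lambda>i. z1 * T i z1 - z2 * T i z2)"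
  have x: "x \<in> carrier_vec n" by (simp add: x_def)
  have Mx: "M *\<^sub>v x = Matrix.vec n (\<lambda>i. z1 * (z1 * T i z1) - z2 * (z2 * T i z2))"
  proof (rule eq_vecI)
    fix i assume "i < dim_vec (Matrix.vec n (\<lambda>i. z1 * (z1 * T i z1) - z2 * (z2 * T i z2)))"
    hence i: "i < n" by simp
    define g where "g = complex_of_real (sqrt (1 - (cmod (a i))\<^sup>2)) * (\<Prod>k = i + 1..<n. - cnj (a k))"
    have row: "(\<Sum>j<n. M $$ (i, j) * T j z) = z * T i z - B z * g" if "cmod z = 1" for z
      using blaschke_mat_mult_takenaka[OF as that, of i] i
      by (simp add: a_def n_def M_def T_def B_def g_def)
    have "vec_index (M *\<^sub>v x) i = (\<Sum>j<n. M $$ (i, j) * (z1 * T j z1 - z2 * T j z2))"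
      using i M by (simp add: x_def scalar_prod_def lessThan_atLeast0)
    also have "\<dots> = z1 * (\<Sum>j<n. M $$ (i, j) * T j z1) - z2 * (\<Sum>j<n. M $$ (i, j) * T j z2)"
      by (simp add: algebra_simps sum_subtractf sum_distrib_left)
    also have "\<dots> = z1 * (z1 * T i z1) - z2 * (z2 * T i z2) - (z1 * B z1 - z2 * B z2) * g"
      unfolding row[OF assms(2)] row[OF assms(3)] by (simp add: algebra_simps)
    finally show "vec_index (M *\<^sub>v x) i = vec_index (Matrix.vec n (\<lambda>i. z1 * (z1 * T i z1) - z2 * (z2 * T i z2))) i"
      using eq i by simp
  qed (use M in auto)
  have form: "Matrix.vec n (\<lambda>i. \<alpha> * T i z1 - \<beta> * T i z2) \<bullet>c x =
      \<alpha> * cnj z1 * K z1 z1 - \<alpha> * cnj z2 * K z1 z2 - \<beta> * cnj z1 * K z2 z1 + \<beta> * cnj z2 * K z2 z2" for \<alpha> \<beta>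
    by (simp add: x_def scalar_prod_def K_def lessThan_atLeast0 algebra_simps sum_subtractf
        sum.distrib sum_distrib_left)
  have norm_x: "x \<bullet>c x = complex_of_real (k z1 + k z2 + 2)"
  proof -
    have "x \<bullet>c x = (z1 * cnj z1) * K z1 z1 - z1 * cnj z2 * K z1 z2 - z2 * cnj z1 * K z2 z1
        + (z2 * cnj z2) * K z2 z2"
      using form[of z1 z2] by (simp add: x_def)
    thus ?thesis unfolding K12 K21 un k by simp
  qed
  have form_x: "(M *\<^sub>v x) \<bullet>c x = complex_of_real (k z1 + 1) * z1 + complex_of_real (k z2 + 1) * z2"
  proof -
    have "(M *\<^sub>v x) \<bullet>c x = z1 * (z1 * cnj z1) * K z1 z1 - z1 * (z1 * cnj z2 * K z1 z2)
        - z2 * (z2 * cnj z1 * K z2 z1) + z2 * (z2 * cnj z2) * K z2 z2"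
      using form[of "z1 * z1" "z2 * z2"] by (simp add: Mx mult.assoc)
    thus ?thesis unfolding K12 K21 un k by (simp add: algebra_simps)
  qed
  define s where "s = (k z2 + 1) / (k z1 + k z2 + 2)"
  have pos: "k z1 + k z2 + 2 > 0" using k0[of z1] k0[of z2] by linarith
  have s1: "1 - s = (k z1 + 1) / (k z1 + k z2 + 2)"
    using pos by (simp add: s_def field_simps)
  define p where "p = (1 - s) *\<^sub>R z1 + s *\<^sub>R z2"
  have "p * complex_of_real D = complex_of_real ((1 - s) * D) * z1 + complex_of_real (s * D) * z2" for D
    unfolding p_def scaleR_conv_of_real by (simp add: algebra_simps)
  note this[of "k z1 + k z2 + 2"]
  also have "(1 - s) * (k z1 + k z2 + 2) = k z1 + 1" unfolding s1 using pos by simp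
  also have "s * (k z1 + k z2 + 2) = k z2 + 1" unfolding s_def using pos by simp
  finally have "(M *\<^sub>v x) \<bullet>c x = p * (x \<bullet>c x)" using norm_x form_x by simp
  moreover have "x \<noteq> 0\<^sub>v n"
  proof
    assume "x = 0\<^sub>v n"
    hence "x \<bullet>c x = 0" by simp
    thus False using norm_x pos of_real_eq_0_iff by (metis less_irrefl)
  qed
  ultimately have "p \<in> numerical_range M" using numerical_rangeI[OF M x] by blast
  moreover have "p \<in> closed_segment z1 z2"
  proof -
    have "0 \<le> s" "s \<le> 1" using k0[of z1] k0[of z2] by (auto simp: s_def field_simps)
    thus ?thesis by (auto simp: p_def in_segment)
  qed
  ultimately show ?thesis by (auto simp: M_def)
qed

section \<open>Arguments of Blaschke factors and the support function for real zeros\<close>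

lemma Arg_upper_half_plane:
  assumes "Im z > 0"
  shows "Arg z = pi / 2 - arctan (Re z / Im z)"
proof -
  define \<phi> where "\<phi> = pi / 2 - arctan (Re z / Im z)"
  have \<phi>: "0 < \<phi>" "\<phi> < pi"
    using arctan_bounded[of "Re z / Im z"] unfolding \<phi>_def by linarith+
  define r where "r = Im z / sin \<phi>"
  have s: "sin \<phi> = cos (arctan (Re z / Im z))" "cos \<phi> = sin (arctan (Re z / Im z))"
    by (simp_all add: \<phi>_def sin_diff cos_diff)
  have sp: "sin \<phi> > 0" using \<phi> by (simp add: sin_gt_zero)
  have "cos \<phi> / sin \<phi> = Re z / Im z"
    unfolding s using tan_arctan[of "Re z / Im z"] by (simp add: tan_def)
  hence z: "z = rcis r \<phi>"
    using sp assms by (auto simp: complex_eq_iff r_def field_simps)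
  have "r > 0" using assms sp by (simp add: r_def)
  hence "Arg z = \<phi>" by (rule Arg_unique'[OF _ _ z]) (use \<phi> in auto)
  thus ?thesis by (simp only: \<phi>_def)
qed

text \<open>
  For \<open>z = u cis x\<close> and \<open>z' = u cis (-x)\<close> the quantity \<open>poncelet_factor s u x\<close> is
  \<open>(z - s) (1 - s z') / u\<close>, so its argument is half that of the quotient of the values of the
  Blaschke factor at \<open>z\<close> and \<open>z'\<close>.
\<close>

definition poncelet_factor :: "real \<Rightarrow> complex \<Rightarrow> real \<Rightarrow> complex" where
  "poncelet_factor s u x = Complex ((1 + s\<^sup>2) * cos x - 2 * s * Re u) ((1 - s\<^sup>2) * sin x)"

lemma poncelet_factor_eq:
  assumes "cmod u = 1"
  shows "u * poncelet_factor s u x = (u * cis x - of_real s) * (1 - of_real s * (u * cis (-x)))"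
proof -
  have "u * cnj u = 1" using assms by (simp flip: complex_norm_square)
  hence u: "u * (u + cnj u) = u * u + 1" by (simp add: distrib_left)
  have P: "poncelet_factor s u x = cis x + of_real (s\<^sup>2) * cis (-x) - of_real s * (u + cnj u)"
    by (simp add: poncelet_factor_def complex_eq_iff algebra_simps)
  have "u * poncelet_factor s u x = u * cis x + of_real (s\<^sup>2) * (u * cis (-x)) - of_real s * (u * (u + cnj u))"
    unfolding P by (simp add: algebra_simps)
  also have "\<dots> = u * cis x + of_real (s\<^sup>2) * (u * cis (-x)) - of_real s * ((u * cis x) * (u * cis (-x)) + 1)"
    unfolding u by (simp add: cis_mult mult.left_commute[of "cis x"] mult.assoc)
  finally show ?thesis by (simp add: algebra_simps power2_eq_square)
qed

lemma poncelet_factor_Im_pos: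
  assumes "\<bar>s\<bar> < 1" "0 < x" "x < pi"
  shows "Im (poncelet_factor s u x) > 0"
  using assms by (simp add: poncelet_factor_def sin_gt_zero abs_square_less_1)

lemma poncelet_factor_zero:
  assumes "\<bar>s\<bar> < 1" "cmod u = 1"
  shows "Im (poncelet_factor s u 0) = 0" "Re (poncelet_factor s u 0) > 0"
proof -
  have "\<bar>s * Re u\<bar> \<le> \<bar>s\<bar>" using assms abs_Re_le_cmod[of u] by (simp add: abs_mult mult_left_le)
  moreover have "(1 - \<bar>s\<bar>)\<^sup>2 > 0" using assms by simp
  hence "1 + s\<^sup>2 - 2 * \<bar>s\<bar> > 0" by (simp add: power2_eq_square algebra_simps)
  ultimately show "Re (poncelet_factor s u 0) > 0" by (simp add: poncelet_factor_def)
qed (simp add: poncelet_factor_def)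

text \<open>The real part of \<open>poncelet_factor\<close> is even in \<open>x\<close> and its
  imaginary part odd, so exchanging \<open>z\<close> and \<open>z'\<close> conjugates it. The
  quotient of the two Blaschke factors is thus P / cnj P, whose argument is twice that of P.\<close>

lemma blaschke_factor_ratio:
  assumes s: "\<bar>s\<bar> < 1" and u: "cmod u = 1" and x: "0 < x" "x < pi"
  defines "z \<equiv> u * cis x" and "z' \<equiv> u * cis (-x)"
  shows "(z - of_real s) / (1 - of_real s * z) =
    cis (2 * Arg (poncelet_factor s u x)) * ((z' - of_real s) / (1 - of_real s * z'))"
proof -
  define P where "P = poncelet_factor s u x"
  define A where "A = cis (Arg P)"
  have P0: "P \<noteq> 0" using poncelet_factor_Im_pos[OF s x, of u] by (auto simp: P_def)
  have cm: "cmod z = 1" "cmod z' = 1" using u by (simp_all add: z_def z'_def norm_mult)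
  have nz: "1 - of_real s * z \<noteq> 0" "1 - of_real s * z' \<noteq> 0"
    using blaschke_denominator_nonzero[of "of_real s" z] blaschke_denominator_nonzero[of "of_real s" z'] s cm
    by auto
  have 1: "u * P = (z - of_real s) * (1 - of_real s * z')"
    unfolding P_def z_def z'_def by (rule poncelet_factor_eq[OF u])
  have "cnj P = poncelet_factor s u (-x)" by (simp add: P_def poncelet_factor_def complex_eq_iff)
  hence 2: "u * cnj P = (z' - of_real s) * (1 - of_real s * z)"
    using poncelet_factor_eq[OF u, of s "-x"] by (simp add: z_def z'_def)
  have "P = of_real (cmod P) * A"
    using rcis_cmod_Arg[of P] by (simp add: A_def rcis_def)
  moreover have "cnj A * A = 1" by (simp add: A_def cis_cnj cis_mult)
  ultimately have "P = A * A * cnj P"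
    by (metis complex_cnj_complex_of_real complex_cnj_mult mult.assoc mult.commute mult.right_neutral)
  hence "u * P = u * (A * A * cnj P)" by (rule arg_cong)
  hence "u * P = A * A * (u * cnj P)" by (simp only: mult.left_commute)
  hence "(z - of_real s) * (1 - of_real s * z') = A * A * ((z' - of_real s) * (1 - of_real s * z))"
    unfolding 1 2 .
  hence "(z - of_real s) / (1 - of_real s * z) = A * A * ((z' - of_real s) / (1 - of_real s * z'))"
    using nz by (simp add: divide_simps mult.assoc)
  moreover have "A * A = cis (2 * Arg P)" by (simp add: A_def cis_mult)
  ultimately show ?thesis by (simp add: P_def)
qed

lemma poncelet_chord_exists:
  assumes s: "\<And>j. j < n \<Longrightarrow> \<bar>s j\<bar> < 1" and u: "cmod u = 1" and d: "0 < d" "d < pi"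
    and arg: "pi \<le> d + (\<Sum>j<n. Arg (poncelet_factor (s j) u d))"
  obtains x where "0 < x" "x \<le> d"
    "u * cis x * blaschke (\<lambda>j. of_real (s j)) n (u * cis x) =
      u * cis (-x) * blaschke (\<lambda>j. of_real (s j)) n (u * cis (-x))"
proof -
  define F where "F x = x + (\<Sum>j<n. Arg (poncelet_factor (s j) u x))" for x
  have "continuous_on {0..d} F"
    unfolding F_def
  proof (intro continuous_intros)
    fix j assume "j \<in> {..<n}"
    hence sj: "\<bar>s j\<bar> < 1" using s by simp
    show "continuous_on {0..d} (poncelet_factor (s j) u)"
      unfolding poncelet_factor_def Complex_eq by (intro continuous_intros)
    fix x assume "x \<in> {0..d}"
    thus "poncelet_factor (s j) u x \<notin> \<real>\<^sub>\<le>\<^sub>0"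
      using poncelet_factor_zero[OF sj u] poncelet_factor_Im_pos[OF sj, of x u] d
      by (cases "x = 0") (auto simp: complex_nonpos_Reals_iff)
  qed
  moreover have "F 0 = 0"
  proof -
    have "(\<Sum>j<n. Arg (poncelet_factor (s j) u 0)) = 0"
      by (intro sum.neutral) (simp add: Arg_eq_0 complex_is_Real_iff poncelet_factor_zero[OF s u] less_imp_le)
    thus ?thesis by (simp add: F_def)
  qed
  ultimately obtain x where x: "x \<in> {0..d}" "F x = pi"
    using IVT'[of F 0 pi d] arg d by (auto simp: F_def)
  have x0: "0 < x" "x < pi" using x \<open>F 0 = 0\<close> d by (auto simp: less_le)
  define B where "B = blaschke (\<lambda>j. of_real (s j)) n"
  have "B (u * cis x) = (\<Prod>j<n. cis (2 * Arg (poncelet_factor (s j) u x))) * B (u * cis (-x))"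
    unfolding B_def blaschke_def prod.distrib[symmetric]
    using blaschke_factor_ratio[OF s u x0] by (intro prod.cong) auto
  also have "(\<Prod>j<n. cis (2 * Arg (poncelet_factor (s j) u x))) = cis (2 * (\<Sum>j<n. Arg (poncelet_factor (s j) u x)))"
    unfolding sum_distrib_left by (induction n) (simp_all add: cis_mult add.commute)
  also have "2 * (\<Sum>j<n. Arg (poncelet_factor (s j) u x)) = 2 * pi + -(2 * x)"
    using x(2) by (simp add: F_def)
  also have "cis \<dots> = cis (-(2 * x))" by (simp add: complex_eq_iff sin_diff cos_diff)
  finally have "u * cis x * B (u * cis x) = u * (cis x * cis (-(2 * x))) * B (u * cis (-x))"
    by simp
  also have "cis x * cis (-(2 * x)) = cis (-x)" by (simp add: cis_mult)
  finally show ?thesis using that[of x] x x0 by (simp add: B_def)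
qed

text \<open>The chord with ends u cis x and u cis (-x) is orthogonal to \<open>u\<close>, and all
  its points have inner product cos x with \<open>u\<close>. It is therefore irrelevant which of
  them lies in the numerical range. The assumption is the condition on arguments, with each argument
  written as pi / 2 minus an arctangent.\<close>

lemma numerical_range_support:
  fixes rs :: "real list"
  assumes rs: "\<And>s. s \<in> set rs \<Longrightarrow> \<bar>s\<bar> < 1" and u: "cmod u = 1" and d: "0 < d" "d < pi"
    and arctan: "(\<Sum>s\<leftarrow>rs. arctan (((1 + s\<^sup>2) * cos d - 2 * s * Re u) / ((1 - s\<^sup>2) * sin d)))
      \<le> length rs * (pi / 2) - (pi - d)"
  shows "\<exists>w \<in> numerical_range (blaschke_mat (map of_real rs)). cos d \<le> inner u w"
proof -
  let ?n = "length rs"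
  have lt: "\<bar>rs ! j\<bar> < 1" if "j < ?n" for j using rs that by simp
  have "Arg (poncelet_factor s u d) = pi / 2 - arctan (((1 + s\<^sup>2) * cos d - 2 * s * Re u) / ((1 - s\<^sup>2) * sin d))"
    if "\<bar>s\<bar> < 1" for s
    using Arg_upper_half_plane[OF poncelet_factor_Im_pos[OF that d, of u]] by (simp add: poncelet_factor_def)
  hence "(\<Sum>j<?n. Arg (poncelet_factor (rs ! j) u d)) =
      (\<Sum>j<?n. pi / 2 - arctan (((1 + (rs ! j)\<^sup>2) * cos d - 2 * (rs ! j) * Re u) / ((1 - (rs ! j)\<^sup>2) * sin d)))"
    using lt by (intro sum.cong) auto
  also have "\<dots> = ?n * (pi / 2) -
      (\<Sum>s\<leftarrow>rs. arctan (((1 + s\<^sup>2) * cos d - 2 * s * Re u) / ((1 - s\<^sup>2) * sin d)))"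
    by (simp add: sum_list_sum_nth sum_subtractf lessThan_atLeast0)
  finally have "pi \<le> d + (\<Sum>j<?n. Arg (poncelet_factor (rs ! j) u d))"
    using arctan by simp
  then obtain x where x: "0 < x" "x \<le> d"
    and eq: "u * cis x * blaschke (\<lambda>j. of_real (rs ! j)) ?n (u * cis x) =
      u * cis (-x) * blaschke (\<lambda>j. of_real (rs ! j)) ?n (u * cis (-x))"
    using poncelet_chord_exists[of ?n "(!) rs" u d] lt u d by metis
  have "blaschke (\<lambda>j. of_real (rs ! j)) ?n = blaschke ((!) (map of_real rs)) (length (map of_real rs :: complex list))"
    by (rule ext) (simp add: blaschke_def)
  moreover have "u * cis x \<noteq> u * cis (-x)"
  proof
    assume "u * cis x = u * cis (-x)"
    hence "cis x = cis (-x)" using u by auto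
    hence "sin x = 0" by (simp add: complex_eq_iff)
    thus False using sin_gt_zero[of x] x d by simp
  qed
  moreover have "set (map of_real rs) \<subseteq> unit_disk" using rs by (auto simp: unit_disk_def)
  ultimately obtain w where w: "w \<in> closed_segment (u * cis x) (u * cis (-x))"
    "w \<in> numerical_range (blaschke_mat (map of_real rs))"
    using numerical_range_meets_chord[of "map of_real rs" "u * cis x" "u * cis (-x)"] eq u
    by (auto simp: norm_mult)
  have "inner u (u * cis y) = cos y" for y
  proof -
    have "inner u (u * cis y) = ((Re u)\<^sup>2 + (Im u)\<^sup>2) * cos y"
      by (simp add: inner_complex_def power2_eq_square algebra_simps)
    thus ?thesis using u by (simp flip: cmod_power2)
  qed
  moreover obtain \<mu> where "w = (1 - \<mu>) *\<^sub>R (u * cis x) + \<mu> *\<^sub>R (u * cis (- x))"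
    using w(1) by (auto simp: in_segment)
  ultimately have "inner u w = (1 - \<mu>) * cos x + \<mu> * cos (- x)"
    by (simp only: inner_add_right inner_scaleR_right)
  hence "inner u w = cos x" by (simp add: algebra_simps)
  moreover have "cos d \<le> cos x" using x d by (intro cos_monotone_0_pi_le) auto
  ultimately show ?thesis by (intro bexI[OF _ w(2)]) simp
qed

section \<open>From support functions to pseudohyperbolic disks\<close>

text \<open>A hyperplane separates a point outside \<open>W\<close> from \<open>W\<close>; the
  support bound in the direction opposite to its normal puts that point at distance at least
  \<open>R\<close> from the centre. The ball is open, so weak separation is enough.\<close>

lemma ball_subset_of_support:
  fixes W :: "complex set"
  assumes W: "convex W"
    and supp: "\<And>u. cmod u = 1 \<Longrightarrow> \<exists>w\<in>W. c * Re u + R \<le> inner u w"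
  shows "ball (of_real c) R \<subseteq> W"
proof
  fix p :: complex assume p: "p \<in> ball (of_real c) R"
  show "p \<in> W"
  proof (rule ccontr)
    assume "p \<notin> W"
    moreover have "W \<noteq> {}" using supp[of 1] by auto
    ultimately obtain a b where a: "a \<noteq> 0" "inner a p \<le> b" "\<And>w. w \<in> W \<Longrightarrow> b \<le> inner a w"
      using separating_hyperplane_sets[of "{p}" W] W by auto
    define u where "u = - (a /\<^sub>R norm a)"
    have u: "cmod u = 1" using a by (simp add: u_def)
    obtain w where w: "w \<in> W" "c * Re u + R \<le> inner u w" using supp[OF u] by auto
    have "inner u w \<le> inner u p"
      using a(2) a(3)[OF w(1)] by (simp add: u_def divide_right_mono mult_left_mono)
    hence "R \<le> inner u (p - of_real c)"
      using w(2) by (simp add: inner_diff_right) (simp add: inner_complex_def mult.commute)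
    also have "\<dots> \<le> norm (p - of_real c)"
      using norm_cauchy_schwarz[of u "p - of_real c"] u by simp
    finally show False using p by (simp add: dist_norm norm_minus_commute)
  qed
qed

text \<open>
  With \<open>L = 2 b - 1\<close> and \<open>1 - 2 a\<close> the left and right end of the Euclidean disk, the
  pseudohyperbolic disk is the one of radius \<open>r\<close> with left end \<open>L\<close>; the hypothesis compares the
  Cayley transforms \<open>(1 + x) / (1 - x)\<close> of the right ends.
\<close>

lemma pseudohyperbolic_disk_subset_ball:
  assumes a: "0 < a" and b: "0 < b" "b < 1" and r: "0 < r" "r < 1"
    and ab: "(1 + r)\<^sup>2 * (a * b) \<le> (1 - r)\<^sup>2 * ((1 - a) * (1 - b))"
  shows "\<exists>z0 \<in> unit_disk. pseudohyperbolic_disk z0 r \<subseteq> ball (of_real (b - a)) (1 - a - b)"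
proof -
  define L where "L = 2 * b - 1"
  \<comment> \<open>\<open>z0\<close> lies at pseudohyperbolic distance \<open>r\<close> to the
    right of \<open>L\<close>, and \<open>H / G\<close> at distance \<open>r\<close> to the right of
    \<open>z0\<close>: these are the centre and the right end of the pseudohyperbolic disk.\<close>
  define G where "G = 1 + r\<^sup>2 + 2 * r * L"
  define H where "H = L * (1 + r\<^sup>2) + 2 * r"
  define z0 where "z0 = (L + r) / (1 + r * L)"
  have L: "-1 < L" "L < 1" using b by (simp_all add: L_def)
  have rL: "1 + r * L > 0"
  proof -
    have "r * (-1) \<le> r * L" using L r by (intro mult_left_mono) auto
    thus ?thesis using r by linarith
  qed
  have G: "G > 0"
  proof -
    have "G = (1 + r)\<^sup>2 * b + (1 - r)\<^sup>2 * (1 - b)"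
      by (simp add: G_def L_def power2_eq_square algebra_simps)
    thus ?thesis using b r by (simp add: add_pos_pos)
  qed
  have HG: "H \<le> G * (1 - 2 * a)"
  proof -
    have "G * (1 - 2 * a) - H = 2 * ((1 - r)\<^sup>2 * ((1 - a) * (1 - b)) - (1 + r)\<^sup>2 * (a * b))"
      by (simp add: G_def H_def L_def power2_eq_square algebra_simps)
    thus ?thesis using ab by simp
  qed
  have HL: "H \<ge> G * L"
  proof -
    have "H - G * L = 2 * r * (1 - L\<^sup>2)" by (simp add: G_def H_def power2_eq_square algebra_simps)
    moreover have "L\<^sup>2 \<le> 1" using L by (simp add: abs_square_le_1)
    ultimately show ?thesis using r by (metis diff_ge_0_iff_ge mult_nonneg_nonneg less_imp_le zero_le_numeral)
  qed
  have "\<bar>z0\<bar> < 1"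
  proof -
    have "0 < (1 + L) * (1 + r)" "0 < (1 - L) * (1 - r)" using L r by simp_all
    hence "L + r < 1 + r * L" "- (L + r) < 1 + r * L" by (simp_all add: algebra_simps)
    thus ?thesis using rL by (simp add: z0_def abs_less_iff divide_simps)
  qed
  moreover have "pseudohyperbolic_disk (of_real z0) r \<subseteq> ball (of_real (b - a)) (1 - a - b)"
  proof
    fix z assume "z \<in> pseudohyperbolic_disk (of_real z0) r"
    hence z: "cmod z < 1" and ph: "cmod ((z - z0) / (1 - z0 * z)) < r"
      by (simp_all add: pseudohyperbolic_disk_def unit_disk_def)
    define x where "x = Re z"
    define y where "y = Im z"
    have "1 - z0 * z \<noteq> 0"
    proof
      assume "1 - z0 * z = 0"
      hence "cmod (z0 * z) = 1" by simp
      thus False using z \<open>\<bar>z0\<bar> < 1\<close> mult_strict_mono'[of "\<bar>z0\<bar>" 1 "cmod z" 1] by (simp add: norm_mult)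
    qed
    hence "cmod (z - z0) < r * cmod (1 - z0 * z)"
      using ph by (simp add: norm_divide divide_simps)
    hence "(1 + r * L) * cmod (z - z0) < (1 + r * L) * (r * cmod (1 - z0 * z))"
      using rL by simp
    moreover have z0: "(1 + r * L) * z0 = L + r" using rL by (simp add: z0_def)
    have "(1 + r * L) * cmod (z - z0) = cmod ((1 + r * L) * z - (L + r))"
    proof -
      have "(1 + r * L) * z - (L + r) = of_real (1 + r * L) * (z - z0)"
        unfolding z0[symmetric] by (simp add: algebra_simps)
      thus ?thesis using rL by (simp only: norm_mult norm_of_real abs_of_pos)
    qed
    moreover have "(1 + r * L) * (r * cmod (1 - z0 * z)) = r * cmod ((1 + r * L) - (L + r) * z)"
    proof -
      have "(1 + r * L) - (L + r) * z = of_real (1 + r * L) * (1 - z0 * z)"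
        unfolding z0[symmetric] by (simp add: algebra_simps)
      hence "cmod ((1 + r * L) - (L + r) * z) = (1 + r * L) * cmod (1 - z0 * z)"
        using rL by (simp only: norm_mult norm_of_real abs_of_pos)
      thus ?thesis by simp
    qed
    ultimately have "cmod ((1 + r * L) * z - (L + r)) < r * cmod ((1 + r * L) - (L + r) * z)" by simp
    hence "(cmod ((1 + r * L) * z - (L + r)))\<^sup>2 < (r * cmod ((1 + r * L) - (L + r) * z))\<^sup>2"
      by (intro power_strict_mono) auto
    hence "((1 + r * L) * x - (L + r))\<^sup>2 + ((1 + r * L) * y)\<^sup>2 <
        r\<^sup>2 * (((1 + r * L) - (L + r) * x)\<^sup>2 + ((L + r) * y)\<^sup>2)"
      by (simp add: power_mult_distrib cmod_power2 x_def y_def)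
    \<comment> \<open>Up to the positive factor in front, this is the equation of the disk with
      diameter from \<open>L\<close> to \<open>H / G\<close>.\<close>
    hence "(1 - r\<^sup>2) * ((x - L) * (G * x - H) + G * y\<^sup>2) < 0"
      by (simp add: G_def H_def power2_eq_square algebra_simps)
    moreover have "1 - r\<^sup>2 > 0" using r by (simp add: abs_square_less_1)
    ultimately have neg: "(x - L) * (G * x - H) + G * y\<^sup>2 < 0" by (simp add: mult_less_0_iff)
    moreover have "G * y\<^sup>2 \<ge> 0" using G by simp
    ultimately have neg': "(x - L) * (G * x - H) < 0" by linarith
    have xL: "x > L"
    proof (rule ccontr)
      assume "\<not> x > L"
      hence "x - L \<le> 0" by simp
      moreover have "G * x \<le> G * L" using \<open>\<not> x > L\<close> G by simp
      ultimately have "0 \<le> (x - L) * (G * x - H)" using HL by (intro mult_nonpos_nonpos) auto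
      thus False using neg' by simp
    qed
    have "(x - L) * (G * (x - (1 - 2 * a))) \<le> (x - L) * (G * x - H)"
      using xL HG by (intro mult_left_mono) (auto simp: algebra_simps)
    hence "G * ((x - L) * (x - (1 - 2 * a)) + y\<^sup>2) < 0" using neg by (simp add: algebra_simps)
    hence lt: "(x - L) * (x - (1 - 2 * a)) + y\<^sup>2 < 0" using G by (simp add: mult_less_0_iff)
    hence "(x - L) * (x - (1 - 2 * a)) < 0" using zero_le_power2[of y] by linarith
    hence "x < 1 - 2 * a" using xL by (simp add: mult_less_0_iff)
    hence R: "1 - a - b > 0" using xL by (simp add: L_def)
    have "(cmod (z - of_real (b - a)))\<^sup>2 = (x - L) * (x - (1 - 2 * a)) + y\<^sup>2 + (1 - a - b)\<^sup>2"
      unfolding cmod_power2 by (simp add: x_def y_def L_def power2_eq_square algebra_simps)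
    hence "(cmod (z - of_real (b - a)))\<^sup>2 < (1 - a - b)\<^sup>2" using lt by simp
    hence "cmod (z - of_real (b - a)) < 1 - a - b" using R by (metis less_imp_le power2_less_imp_less)
    thus "z \<in> ball (of_real (b - a)) (1 - a - b)" by (simp add: dist_norm norm_minus_commute)
  qed
  ultimately show ?thesis by (intro bexI[of _ "of_real z0"]) (auto simp: unit_disk_def)
qed

text \<open>Centre and radius are chosen so that the support function of the disk in direction
  \<open>u\<close> is exactly cos d. The rational \<open>r\<close> stands in for the required radius
  and only enlarges the disk. The last premise on \<open>S\<close> is concavity of the square root,
  handed on because the estimates need \<open>S\<close> itself from below, not only its
  square.\<close>

lemma real_zeros_disk_criterion:
  fixes rs :: "real list"
  assumes rs: "\<And>s. s \<in> set rs \<Longrightarrow> \<bar>s\<bar> < 1"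
    and \<alpha>: "0 < \<alpha>" "\<alpha> < 1" and \<beta>: "0 < \<beta>" "\<beta> < 1" and r: "0 < r" "r < 1"
    and r_ge: "(1 / 2) powr (1 / (real (length rs) - 1)) \<le> r"
    and \<alpha>\<beta>: "(1 + r)\<^sup>2 * (\<alpha>\<^sup>2 * \<beta>\<^sup>2) \<le> (1 - r)\<^sup>2 * ((1 - \<alpha>\<^sup>2) * (1 - \<beta>\<^sup>2))"
    and arctan: "\<And>v S d. \<lbrakk>0 \<le> v; v \<le> 1; 0 < d; d < pi; S = sin (d / 2); S\<^sup>2 = (1 - v) * \<alpha>\<^sup>2 + v * \<beta>\<^sup>2;
        (1 - v) * \<alpha> + v * \<beta> \<le> S\<rbrakk> \<Longrightarrow>
      (\<Sum>s\<leftarrow>rs. arctan (((1 + s\<^sup>2) * (1 - 2 * S\<^sup>2) - 2 * s * (1 - 2 * v)) / ((1 - s\<^sup>2) * sin d)))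
        \<le> length rs * (pi / 2) - (pi - d)"
  shows "pseudohyperbolic_disk_criterion (map of_real rs)"
proof -
  let ?W = "numerical_range (blaschke_mat (map of_real rs))"
  define R where "R = 1 - \<alpha>\<^sup>2 - \<beta>\<^sup>2"
  have sq: "0 < \<alpha>\<^sup>2" "\<alpha>\<^sup>2 < 1" "0 < \<beta>\<^sup>2" "\<beta>\<^sup>2 < 1"
    using \<alpha> \<beta> by (simp_all add: power_less_one_iff)
  obtain z0 where z0: "z0 \<in> unit_disk" "pseudohyperbolic_disk z0 r \<subseteq> ball (of_real (\<beta>\<^sup>2 - \<alpha>\<^sup>2)) R"
    using pseudohyperbolic_disk_subset_ball[OF sq(1,3,4) r \<alpha>\<beta>] by (auto simp: R_def)
  have "ball (of_real (\<beta>\<^sup>2 - \<alpha>\<^sup>2)) R \<subseteq> ?W"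
  proof (rule ball_subset_of_support)
    show "convex ?W" by (rule convex_numerical_range[OF blaschke_mat_carrier])
    fix u :: complex assume u: "cmod u = 1"
    define v where "v = (1 - Re u) / 2"
    have v: "0 \<le> v" "v \<le> 1" using abs_Re_le_cmod[of u] u by (auto simp: v_def)
    have Re_u: "Re u = 1 - 2 * v" by (simp add: v_def field_simps)
    define S where "S = sqrt ((1 - v) * \<alpha>\<^sup>2 + v * \<beta>\<^sup>2)"
    have pos: "0 < (1 - v) * \<alpha>\<^sup>2 + v * \<beta>\<^sup>2"
      using v sq by (cases "v = 0") (auto intro!: add_nonneg_pos)
    have "(1 - v) * \<alpha>\<^sup>2 + v * \<beta>\<^sup>2 < 1"
      using convex_bound_lt[of "\<alpha>\<^sup>2" 1 "\<beta>\<^sup>2" "1 - v" v] v sq by simp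
    hence S: "0 < S" "S < 1" "S\<^sup>2 = (1 - v) * \<alpha>\<^sup>2 + v * \<beta>\<^sup>2"
      using pos by (simp_all add: S_def)
    have conc: "(1 - v) * \<alpha> + v * \<beta> \<le> S"
      unfolding S_def
    proof (rule real_le_rsqrt)
      have "(1 - v) * \<alpha>\<^sup>2 + v * \<beta>\<^sup>2 - ((1 - v) * \<alpha> + v * \<beta>)\<^sup>2 = (1 - v) * v * (\<alpha> - \<beta>)\<^sup>2"
        by (simp add: power2_eq_square algebra_simps)
      moreover have "0 \<le> (1 - v) * v * (\<alpha> - \<beta>)\<^sup>2" using v by simp
      ultimately show "((1 - v) * \<alpha> + v * \<beta>)\<^sup>2 \<le> (1 - v) * \<alpha>\<^sup>2 + v * \<beta>\<^sup>2" by linarith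
    qed
    define d where "d = 2 * arcsin S"
    have "0 < arcsin S" "arcsin S < pi / 2"
      using arcsin_less_arcsin[of 0 S] arcsin_lt_bounded[of S] S by auto
    hence d: "0 < d" "d < pi" by (simp_all add: d_def)
    have Sd: "S = sin (d / 2)" using S by (simp add: d_def)
    have cos_d: "cos d = 1 - 2 * S\<^sup>2" using cos_double_sin[of "d / 2"] by (simp add: Sd)
    have "\<exists>w\<in>?W. cos d \<le> inner u w"
      using numerical_range_support[OF rs u d] arctan[OF v d Sd S(3) conc]
      unfolding Re_u cos_d by blast
    moreover have "(\<beta>\<^sup>2 - \<alpha>\<^sup>2) * Re u + R = cos d"
      unfolding cos_d S(3) Re_u by (simp add: R_def algebra_simps)
    ultimately show "\<exists>w\<in>?W. (\<beta>\<^sup>2 - \<alpha>\<^sup>2) * Re u + R \<le> inner u w" by simp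
  qed
  moreover have "pseudohyperbolic_disk z0 ((1 / 2) powr (1 / (real (length rs) - 1))) \<subseteq> pseudohyperbolic_disk z0 r"
    using r_ge by (auto simp: pseudohyperbolic_disk_def)
  ultimately show ?thesis
    unfolding pseudohyperbolic_disk_criterion_def using z0 by auto
qed

section \<open>Half-angle cotangents and elementary inequalities\<close>

lemma half_powr_le:
  fixes r :: real
  assumes "0 < r" "0 < k" "1 / 2 \<le> r ^ k"
  shows "(1 / 2) powr (1 / real k) \<le> r"
proof -
  have "(1 / 2) powr (1 / real k) \<le> (r ^ k) powr (1 / real k)"
    using assms by (intro powr_mono2) auto
  also have "\<dots> = r" using assms by (simp add: powr_powr flip: powr_realpow)
  finally show ?thesis .
qed

text \<open>The cotangent of half the argument gained by the Blaschke factor, times \<open>sin d\<close>.\<close>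

definition cot_numerator :: "real \<Rightarrow> real \<Rightarrow> real \<Rightarrow> real" where
  "cot_numerator w v S = (1 - v) * w + v / w - (w + 1 / w) * S\<^sup>2"

text \<open>The substitution turns the coefficients (1 + s^2) / (1 - s^2) and 2 s / (1 - s^2) into
  (1/w + w) / 2 and (1/w - w) / 2. The expression becomes affine in \<open>v\<close> and in the
  square of \<open>S\<close>.\<close>

lemma cot_numerator_eq:
  assumes s: "\<bar>s\<bar> < 1" and w: "w = (1 - s) / (1 + s)"
  shows "((1 + s\<^sup>2) * (1 - 2 * S\<^sup>2) - 2 * s * (1 - 2 * v)) / ((1 - s\<^sup>2) * c) = cot_numerator w v S / c"
proof -
  have nz: "1 + s \<noteq> 0" "1 - s \<noteq> 0" using s by auto
  have sq: "1 - s\<^sup>2 = (1 - s) * (1 + s)" by (simp add: power2_eq_square algebra_simps)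
  have "((1 + s\<^sup>2) * (1 - 2 * S\<^sup>2) - 2 * s * (1 - 2 * v)) / (1 - s\<^sup>2) = cot_numerator w v S"
    unfolding sq cot_numerator_def w using nz
    by (simp add: divide_simps) (simp add: power2_eq_square algebra_simps)
  thus ?thesis by (simp flip: divide_divide_eq_left)
qed

text \<open>After inserting the square of \<open>S\<close>, the numerator is a mean of its values at
  v = 0 and v = 1, and the last two assumptions are these two cases.\<close>

lemma cot_numerator_nonneg:
  assumes "0 \<le> v" "v \<le> 1" "S\<^sup>2 = (1 - v) * \<alpha>\<^sup>2 + v * \<beta>\<^sup>2"
    and \<alpha>: "(w + 1 / w) * \<alpha>\<^sup>2 \<le> w" and \<beta>: "(w + 1 / w) * \<beta>\<^sup>2 \<le> 1 / w"
  shows "0 \<le> cot_numerator w v S"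
proof -
  have "cot_numerator w v S = (1 - v) * (w - (w + 1 / w) * \<alpha>\<^sup>2) + v * (1 / w - (w + 1 / w) * \<beta>\<^sup>2)"
    unfolding cot_numerator_def assms(3)
    by (simp add: algebra_simps add_divide_distrib diff_divide_distrib)
  thus ?thesis using assms by simp
qed

text \<open>This reduces all directions to the two real ones: the quadratic term is affine in
  \<open>v\<close>, and the linear term dominates its interpolation because
  \<open>0 \<le> K\<close>. The sign of \<open>Q\<close> does not enter.\<close>

lemma convex_combination_bound:
  fixes S :: real
  assumes "0 \<le> v" "v \<le> 1" "S\<^sup>2 = (1 - v) * \<alpha>\<^sup>2 + v * \<beta>\<^sup>2" "(1 - v) * \<alpha> + v * \<beta> \<le> S" "0 \<le> K"
    and "p \<le> Q * \<alpha>\<^sup>2 + K * \<alpha>" "q \<le> Q * \<beta>\<^sup>2 + K * \<beta>"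
  shows "(1 - v) * p + v * q \<le> Q * S\<^sup>2 + K * S"
proof -
  have "(1 - v) * p + v * q \<le> (1 - v) * (Q * \<alpha>\<^sup>2 + K * \<alpha>) + v * (Q * \<beta>\<^sup>2 + K * \<beta>)"
    using assms by (intro add_mono mult_left_mono) auto
  also have "\<dots> = Q * S\<^sup>2 + K * ((1 - v) * \<alpha> + v * \<beta>)"
    unfolding assms(3) by (simp add: algebra_simps)
  also have "\<dots> \<le> Q * S\<^sup>2 + K * S" using assms by (intro add_left_mono mult_left_mono) auto
  finally show ?thesis .
qed

text \<open>The arctangent is concave on the nonnegative half line; the mean value theorem compares
  the secant slope with the slope at \<open>x\<close>.\<close>

lemma arctan_tangent_bound:
  fixes x y :: real
  assumes "0 \<le> x" "0 \<le> y"
  shows "arctan y \<le> arctan x + (y - x) / (1 + x\<^sup>2)"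
proof (cases x y rule: linorder_cases)
  case less
  obtain z where z: "x < z" "z < y" "arctan y - arctan x = (y - x) * inverse (1 + z\<^sup>2)"
    using MVT2[OF less, of arctan "\<lambda>z. inverse (1 + z\<^sup>2)"] DERIV_arctan by auto
  have "inverse (1 + z\<^sup>2) \<le> inverse (1 + x\<^sup>2)"
    using z assms by (intro le_imp_inverse_le add_left_mono power_mono) (auto simp: add_pos_nonneg)
  hence "(y - x) * inverse (1 + z\<^sup>2) \<le> (y - x) * inverse (1 + x\<^sup>2)"
    using less by (intro mult_left_mono) auto
  thus ?thesis unfolding divide_inverse using z(3) by linarith
next
  case greater
  obtain z where z: "y < z" "z < x" "arctan x - arctan y = (x - y) * inverse (1 + z\<^sup>2)"
    using MVT2[OF greater, of arctan "\<lambda>z. inverse (1 + z\<^sup>2)"] DERIV_arctan by auto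
  have "inverse (1 + x\<^sup>2) \<le> inverse (1 + z\<^sup>2)"
    using z assms by (intro le_imp_inverse_le add_left_mono power_mono) (auto simp: add_pos_nonneg)
  hence "(x - y) * inverse (1 + x\<^sup>2) \<le> (x - y) * inverse (1 + z\<^sup>2)"
    using greater by (intro mult_left_mono) auto
  moreover have "(x - y) * inverse (1 + x\<^sup>2) = - ((y - x) * inverse (1 + x\<^sup>2))"
    by (simp add: algebra_simps)
  ultimately show ?thesis unfolding divide_inverse using z(3) by linarith
qed simp

lemma sin_cos_quintuple:
  fixes x :: real
  shows "sin (5 * x) = sin x * (16 * (sin x) ^ 4 - 20 * (sin x)\<^sup>2 + 5)"
    and "cos (5 * x) = cos x * (16 * (sin x) ^ 4 - 12 * (sin x)\<^sup>2 + 1)"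
proof -
  have 5: "5 * x = 2 * (2 * x) + x" by simp
  have c: "(cos x)\<^sup>2 = 1 - (sin x)\<^sup>2" by (simp add: cos_squared_eq)
  have s: "sin (5 * x) = 4 * sin x * (1 - 2 * (sin x)\<^sup>2) * (cos x)\<^sup>2
      + (1 - 8 * (sin x)\<^sup>2 * (cos x)\<^sup>2) * sin x"
    unfolding 5 sin_add[of "2 * (2 * x)"] sin_double[of "2 * x"] cos_double_sin[of "2 * x"]
      sin_double[of x] cos_double_sin[of x] by (simp add: power2_eq_square algebra_simps)
  have k: "cos (5 * x) = ((1 - 8 * (sin x)\<^sup>2 * (cos x)\<^sup>2)
      - 4 * (sin x)\<^sup>2 * (1 - 2 * (sin x)\<^sup>2)) * cos x"
    unfolding 5 cos_add[of "2 * (2 * x)"] sin_double[of "2 * x"] cos_double_sin[of "2 * x"]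
      sin_double[of x] cos_double_sin[of x] by (simp add: power2_eq_square algebra_simps)
  show "sin (5 * x) = sin x * (16 * (sin x) ^ 4 - 20 * (sin x)\<^sup>2 + 5)"
    unfolding s c by (simp add: algebra_simps eval_nat_numeral)
  show "cos (5 * x) = cos x * (16 * (sin x) ^ 4 - 12 * (sin x)\<^sup>2 + 1)"
    unfolding k c by (simp add: algebra_simps eval_nat_numeral)
qed

text \<open>Divided by 2 S sin (2x), the right side is sin (5x) cot (2x). It tends to 5/2 as S tends
  to 1 and to cot (pi/5) = 1.3764 as S tends to 0. The left side becomes 9/8 S + 11/8, the line with
  value 5/2 at S = 1 and 11/8 = 1.375 at S = 0.\<close>

lemma quintuple_angle_bound:
  assumes x: "0 < x" "x < pi / 10"
  defines "S \<equiv> cos (5 * x)"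
  shows "sin (2 * x) * (9 / 4 * S\<^sup>2 + 11 / 4 * S) \<le> sin (10 * x) * cos (2 * x)"
proof -
  define s where "s = sin x"
  define c where "c = cos x"
  define q where "q = s\<^sup>2"
  have s: "s > 0" using x by (simp add: s_def sin_gt_zero)
  have c: "c > 0" "c \<le> 1" using x by (simp_all add: c_def cos_gt_zero)
  have cq: "c\<^sup>2 = 1 - q" by (simp add: c_def q_def s_def cos_squared_eq)
  have S0: "S > 0" using x unfolding S_def by (intro cos_gt_zero) auto
  have S: "S = c * (16 * q\<^sup>2 - 12 * q + 1)"
    unfolding S_def sin_cos_quintuple by (simp add: c_def q_def s_def)
  have q0: "q > 0" using s by (simp add: q_def)
  have "cos (2 * x) > 0" using x by (intro cos_gt_zero) auto
  hence "q < 1 / 2" unfolding cos_double_sin by (simp add: q_def s_def)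
  \<comment> \<open>\<open>S\<close> is positive, so 16 q^2 - 12 q + 1 is positive. Its zeros
    0.095... and 0.654... enclose the interval from 1/10 to 1/2.\<close>
  have q: "q \<le> 1 / 10"
  proof (rule ccontr)
    assume "\<not> q \<le> 1 / 10"
    hence "(q - 1 / 10) * (1 / 2 - q) > 0" using \<open>q < 1 / 2\<close> by simp
    moreover have "(q - 1 / 10) * (1 / 2 - q) = 3 / 5 * q - 1 / 20 - q\<^sup>2"
      by (simp add: power2_eq_square field_simps)
    ultimately have "16 * q\<^sup>2 - 12 * q + 1 < 0" using \<open>\<not> q \<le> 1 / 10\<close> by linarith
    hence "S < 0" unfolding S using c by (simp add: mult_pos_neg)
    thus False using S0 by simp
  qed
  have c_le: "c \<le> 1 - q / 2"
  proof (rule power2_le_imp_le)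
    show "c\<^sup>2 \<le> (1 - q / 2)\<^sup>2" unfolding cq by (simp add: power2_eq_square algebra_simps)
  qed (use q in simp)
  have "0 \<le> 44 * (1 - c) - q * (12 + 112 * q - 64 * q\<^sup>2)"
  proof -
    \<comment> \<open>\<open>c\<close> is eliminated through the lower bound q / (2 - q/2) for 1 -
      c, which leaves a cubic polynomial in \<open>q\<close>.\<close>
    have "q = (1 - c) * (1 + c)" using cq by (simp add: power2_eq_square algebra_simps)
    also have "\<dots> \<le> (1 - c) * (2 - q / 2)" using c_le c by (intro mult_left_mono) auto
    finally have 1: "q \<le> (1 - c) * (2 - q / 2)" .
    have "0 \<le> (q - 1 / 10)\<^sup>2" by simp
    hence "q\<^sup>2 \<ge> q / 5 - 1 / 100" by (simp add: power2_eq_square algebra_simps)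
    moreover have "q ^ 3 \<le> q / 100"
      using mult_left_mono[OF power_mono[OF q, of 2], of q] q0 by (simp add: power3_eq_cube power2_eq_square)
    ultimately have "0 \<le> 20 - 218 * q + 184 * q\<^sup>2 - 32 * q ^ 3" using q by simp
    hence "0 \<le> q * (20 - 218 * q + 184 * q\<^sup>2 - 32 * q ^ 3)" using q0 by simp
    also have "\<dots> = 44 * q - q * (12 + 112 * q - 64 * q\<^sup>2) * (2 - q / 2)"
      by (simp add: field_simps eval_nat_numeral)
    also have "\<dots> \<le> 44 * ((1 - c) * (2 - q / 2)) - q * (12 + 112 * q - 64 * q\<^sup>2) * (2 - q / 2)"
      using 1 by simp
    also have "\<dots> = (44 * (1 - c) - q * (12 + 112 * q - 64 * q\<^sup>2)) * (2 - q / 2)"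
      by (simp add: field_simps eval_nat_numeral)
    finally show ?thesis using q by (simp add: zero_le_mult_iff)
  qed
  hence "0 \<le> s / 16 * (44 * (1 - c) - q * (12 + 112 * q - 64 * q\<^sup>2))" using s by simp
  also have "\<dots> = s * (16 * q\<^sup>2 - 20 * q + 5) * (1 - 2 * q)
      - 2 * s * c * (9 / 8 * (c * (16 * q\<^sup>2 - 12 * q + 1)) + 11 / 8)"
  proof -
    have "2 * s * c * (9 / 8 * (c * (16 * q\<^sup>2 - 12 * q + 1)) + 11 / 8) =
        9 / 4 * s * c\<^sup>2 * (16 * q\<^sup>2 - 12 * q + 1) + 11 / 4 * s * c"
      by (simp add: power2_eq_square algebra_simps)
    thus ?thesis unfolding cq by (simp add: field_simps eval_nat_numeral)
  qed
  also have "\<dots> = sin (5 * x) * cos (2 * x) - sin (2 * x) * (9 / 8 * S + 11 / 8)"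
    unfolding S sin_cos_quintuple cos_double_sin sin_double by (simp add: s_def c_def q_def)
  finally have "0 \<le> 2 * S * (sin (5 * x) * cos (2 * x) - sin (2 * x) * (9 / 8 * S + 11 / 8))"
    using S0 by simp
  also have "\<dots> = sin (10 * x) * cos (2 * x) - sin (2 * x) * (9 / 4 * S\<^sup>2 + 11 / 4 * S)"
    using sin_double[of "5 * x"] by (simp add: S_def power2_eq_square algebra_simps)
  finally show ?thesis by simp
qed

text \<open>
  The polynomial inequalities are certified by their Bernstein coefficients on \<open>[0, 1]\<close>.
\<close>

lemma quintuple_left_poly:
  fixes w :: real
  assumes "0 \<le> w" "w \<le> 1"
  shows "0 \<le> (4 + 9 * w + 4 * w\<^sup>2) * (5 - w)\<^sup>2 + 165 * (5 - w) - 900"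
proof -
  have "(4 + 9 * w + 4 * w\<^sup>2) * (5 - w)\<^sup>2 + 165 * (5 - w) - 900 =
      25 * (1 - w) ^ 4 + 120 * w * (1 - w) ^ 3 + 224 * w\<^sup>2 * (1 - w)\<^sup>2 + 157 * w ^ 3 * (1 - w) + 32 * w ^ 4"
    by (simp add: algebra_simps eval_nat_numeral)
  also have "0 \<le> \<dots>"
    using assms by (intro add_nonneg_nonneg mult_nonneg_nonneg zero_le_power) simp_all
  finally show ?thesis .
qed

text \<open>The factor \<open>w\<^sup>2\<close> reflects that \<beta> = (10 - w) / (10 + 24 w)
  agrees to first order at w = 0 with the root it replaces.\<close>

lemma quintuple_right_poly:
  fixes w :: real
  assumes "0 \<le> w" "w \<le> 1"
  shows "0 \<le> (4 + 9 * w + 4 * w\<^sup>2) * (10 - w)\<^sup>2 + 11 * w * (10 - w) * (10 + 24 * w) - 4 * (10 + 24 * w)\<^sup>2"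
proof -
  have "(4 + 9 * w + 4 * w\<^sup>2) * (10 - w)\<^sup>2 + 11 * w * (10 - w) * (10 + 24 * w) - 4 * (10 + 24 * w)\<^sup>2 =
      w\<^sup>2 * (450 * (1 - w)\<^sup>2 + 565 * w * (1 - w) + 119 * w\<^sup>2)"
    by (simp add: algebra_simps eval_nat_numeral)
  also have "0 \<le> \<dots>"
    using assms by (intro add_nonneg_nonneg mult_nonneg_nonneg zero_le_power) simp_all
  finally show ?thesis .
qed

text \<open>The disk condition for \<alpha> = w (5 - w) / 15, \<beta> = (10 - w) / (10 + 24 w) and r
  = 17/20, cleared of denominators: (1 + r) / (1 - r) = 37/3 gives the factors 1369 and 9.\<close>

lemma quintuple_disk_poly:
  fixes w :: real
  assumes "0 \<le> w" "w \<le> 1"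
  shows "1369 * (w * (5 - w))\<^sup>2 * (10 - w)\<^sup>2 \<le>
    9 * (225 - (w * (5 - w))\<^sup>2) * ((10 + 24 * w)\<^sup>2 - (10 - w)\<^sup>2)"
proof -
  have "9 * (225 - (w * (5 - w))\<^sup>2) * ((10 + 24 * w)\<^sup>2 - (10 - w)\<^sup>2) - 1369 * (w * (5 - w))\<^sup>2 * (10 - w)\<^sup>2 =
      w * (1012500 * (1 - w) ^ 5 + 2804375 * w * (1 - w) ^ 4 + 3033500 * w\<^sup>2 * (1 - w) ^ 3
        + 1869950 * w ^ 3 * (1 - w)\<^sup>2 + 882720 * w ^ 4 * (1 - w) + 247851 * w ^ 5)"
    by (simp add: algebra_simps eval_nat_numeral)
  also have "0 \<le> \<dots>"
    using assms by (intro add_nonneg_nonneg mult_nonneg_nonneg zero_le_power) simp_all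
  finally show ?thesis by simp
qed

lemma mixed_left_poly:
  fixes x :: real
  assumes "0 \<le> x" "x \<le> 1"
  shows "(14 + 2 * x\<^sup>2) * (139 + 72 * x + 110 * x\<^sup>2)\<^sup>2 \<le>
    10000 * (5 + 16 * x + 22 * x\<^sup>2 + 16 * x ^ 3 + 5 * x ^ 4) + 1600 * (1 + x\<^sup>2) * (139 + 72 * x + 110 * x\<^sup>2)"
proof -
  have "10000 * (5 + 16 * x + 22 * x\<^sup>2 + 16 * x ^ 3 + 5 * x ^ 4)
        + 1600 * (1 + x\<^sup>2) * (139 + 72 * x + 110 * x\<^sup>2) - (14 + 2 * x\<^sup>2) * (139 + 72 * x + 110 * x\<^sup>2)\<^sup>2 =
      1906 * (1 - x) ^ 6 + 6412 * x * (1 - x) ^ 5 + 82532 * x\<^sup>2 * (1 - x) ^ 4 + 317536 * x ^ 3 * (1 - x) ^ 3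
      + 478018 * x ^ 4 * (1 - x)\<^sup>2 + 281252 * x ^ 5 * (1 - x) + 18544 * x ^ 6"
    by (simp add: algebra_simps eval_nat_numeral)
  also have "0 \<le> \<dots>"
    using assms by (intro add_nonneg_nonneg mult_nonneg_nonneg zero_le_power) simp_all
  finally show ?thesis by simp
qed

lemma mixed_right_poly:
  fixes x :: real
  assumes "0 \<le> x" "x \<le> 1"
  shows "(1 + x\<^sup>2) * (5 + 3 * x\<^sup>2) * (10 + 32 * x + 2 * x\<^sup>2 - 13 * x ^ 3)\<^sup>2 \<le>
    100 * (5 + 16 * x + 22 * x\<^sup>2 + 16 * x ^ 3 + 5 * x ^ 4)
    + 160 * x * (1 + x\<^sup>2) * (10 + 32 * x + 2 * x\<^sup>2 - 13 * x ^ 3)"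
proof -
  have "100 * (5 + 16 * x + 22 * x\<^sup>2 + 16 * x ^ 3 + 5 * x ^ 4)
      + 160 * x * (1 + x\<^sup>2) * (10 + 32 * x + 2 * x\<^sup>2 - 13 * x ^ 3)
      - (1 + x\<^sup>2) * (5 + 3 * x\<^sup>2) * (10 + 32 * x + 2 * x\<^sup>2 - 13 * x ^ 3)\<^sup>2 =
    x\<^sup>2 * (1200 * (1 - x) ^ 8 + 8660 * x * (1 - x) ^ 7 + 25888 * x\<^sup>2 * (1 - x) ^ 6
      + 40384 * x ^ 3 * (1 - x) ^ 5 + 33207 * x ^ 4 * (1 - x) ^ 4 + 11660 * x ^ 5 * (1 - x) ^ 3
      + 650 * x ^ 6 * (1 - x)\<^sup>2 + 1692 * x ^ 7 * (1 - x) + 944 * x ^ 8)"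
    by (simp add: algebra_simps eval_nat_numeral)
  also have "0 \<le> \<dots>"
    using assms by (intro add_nonneg_nonneg mult_nonneg_nonneg zero_le_power) simp_all
  finally show ?thesis by simp
qed

text \<open>The disk condition for r = 27/34, where (1 + r) / (1 - r) = 61/7: the constants are 61^2
  times 10^6 and 7^2, the powers of ten coming from the numerators 100 x of \<alpha> and 10 of
  \<beta>.\<close>

lemma mixed_disk_poly:
  fixes x :: real
  assumes "0 \<le> x" "x \<le> 1"
  shows "3721000000 * x\<^sup>2 \<le>
    49 * ((139 + 72 * x + 110 * x\<^sup>2)\<^sup>2 - 10000 * x\<^sup>2) * ((10 + 32 * x + 2 * x\<^sup>2 - 13 * x ^ 3)\<^sup>2 - 100)"
proof -
  have "49 * ((139 + 72 * x + 110 * x\<^sup>2)\<^sup>2 - 10000 * x\<^sup>2)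
      * ((10 + 32 * x + 2 * x\<^sup>2 - 13 * x ^ 3)\<^sup>2 - 100) - 3721000000 * x\<^sup>2 =
    x * (605906560 * (1 - x) ^ 9 + 3367180456 * x * (1 - x) ^ 8 + 6851352476 * x\<^sup>2 * (1 - x) ^ 7
      + 5501184808 * x ^ 3 * (1 - x) ^ 6 + 1523915456 * x ^ 4 * (1 - x) ^ 5 + 5132828365 * x ^ 5 * (1 - x) ^ 4
      + 12563655440 * x ^ 6 * (1 - x) ^ 3 + 10707434122 * x ^ 7 * (1 - x)\<^sup>2 + 3267904468 * x ^ 8 * (1 - x)
      + 204306749 * x ^ 9)"
    by (simp add: algebra_simps eval_nat_numeral)
  also have "0 \<le> \<dots>"
    using assms by (intro add_nonneg_nonneg mult_nonneg_nonneg zero_le_power) simp_all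
  finally show ?thesis by simp
qed

lemma cayley_in_unit_interval:
  fixes t :: real
  assumes "0 \<le> t" "t < 1"
  shows "0 < (1 - t) / (1 + t)" "(1 - t) / (1 + t) \<le> 1"
  using assms by (simp_all add: field_simps)

section \<open>The product with a zero of multiplicity five\<close>

text \<open>All five arguments are equal, so a single comparison suffices: with x = (pi - d) / 10
  the claim is c <= sin d cot (2x), and \<open>quintuple_angle_bound\<close> supplies a lower bound
  for the right side.\<close>

lemma cot_bound_quintuple:
  assumes d: "0 < d" "d < pi" and S: "S = sin (d / 2)"
    and c: "c \<le> 9 / 4 * S\<^sup>2 + 11 / 4 * S"
  shows "5 * arctan (c / sin d) \<le> 5 * (pi / 2) - (pi - d)"
proof -
  define x where "x = (pi - d) / 10"
  have x: "0 < x" "x < pi / 10" using d by (simp_all add: x_def field_simps)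
  have dx: "d = pi - 10 * x" "d / 2 = pi / 2 - 5 * x" by (simp_all add: x_def field_simps)
  have Sx: "S = cos (5 * x)" unfolding S dx(2) by (simp add: sin_diff)
  have sin_d: "sin d = sin (10 * x)" unfolding dx(1) by (simp add: sin_diff)
  have pos: "sin d > 0" "sin (2 * x) > 0" using d x by (simp_all add: sin_gt_zero)
  have "c * sin (2 * x) \<le> sin d * cos (2 * x)"
  proof -
    have "c * sin (2 * x) \<le> (9 / 4 * S\<^sup>2 + 11 / 4 * S) * sin (2 * x)"
      using c pos by (intro mult_right_mono) auto
    also have "\<dots> \<le> sin d * cos (2 * x)"
      using quintuple_angle_bound[OF x] unfolding Sx sin_d by (simp only: mult.commute)
    finally show ?thesis .
  qed
  hence "c / sin d \<le> cos (2 * x) / sin (2 * x)" using pos by (simp add: divide_simps mult.commute)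
  also have "\<dots> = tan (pi / 2 - 2 * x)" by (simp add: tan_def sin_diff cos_diff)
  finally have "arctan (c / sin d) \<le> arctan (tan (pi / 2 - 2 * x))" by (simp add: arctan_monotone')
  also have "\<dots> = pi / 2 - 2 * x" using x by (intro arctan_tan) (auto simp: field_simps)
  finally show ?thesis by (simp add: x_def field_simps)
qed

lemma quintuple_zero_criterion:
  assumes t: "0 \<le> t" "t < 1"
  shows "pseudohyperbolic_disk_criterion (map of_real [t, t, t, t, t])"
proof -
  define w where "w = (1 - t) / (1 + t)"
  have w: "0 < w" "w \<le> 1" using cayley_in_unit_interval[OF t] by (simp_all add: w_def)
  \<comment> \<open>\<alpha> and \<beta> are simple rational upper bounds for the positive roots y
    of Q y^2 + 11/4 y = w and Q y^2 + 11/4 y = 1/w, the cases v = 0 and v = 1. The disk condition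
    limits how large they may be.\<close>
  define \<alpha> where "\<alpha> = w * (5 - w) / 15"
  define \<beta> where "\<beta> = (10 - w) / (10 + 24 * w)"
  define Q where "Q = w + 1 / w + 9 / 4"
  have D: "10 + 24 * w > 0" using w by simp
  have \<alpha>: "0 < \<alpha>" "\<alpha> < 1"
  proof -
    have "w * (5 - w) \<le> 1 * 5" using w by (intro mult_mono) auto
    thus "0 < \<alpha>" "\<alpha> < 1" using w by (simp_all add: \<alpha>_def)
  qed
  have \<beta>: "0 < \<beta>" "\<beta> < 1" using w by (simp_all add: \<beta>_def)
  have left: "w \<le> Q * \<alpha>\<^sup>2 + 11 / 4 * \<alpha>"
  proof -
    have "Q * \<alpha>\<^sup>2 + 11 / 4 * \<alpha> - w = w / 900 * ((4 + 9 * w + 4 * w\<^sup>2) * (5 - w)\<^sup>2 + 165 * (5 - w) - 900)"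
      using w by (simp add: Q_def \<alpha>_def field_simps power2_eq_square)
    moreover have "0 \<le> \<dots>" using w quintuple_left_poly[of w] by simp
    ultimately show ?thesis by linarith
  qed
  have right: "1 / w \<le> Q * \<beta>\<^sup>2 + 11 / 4 * \<beta>"
  proof -
    have "Q * \<beta>\<^sup>2 + 11 / 4 * \<beta> - 1 / w = 1 / (4 * w * (10 + 24 * w)\<^sup>2) *
        ((4 + 9 * w + 4 * w\<^sup>2) * (10 - w)\<^sup>2 + 11 * w * (10 - w) * (10 + 24 * w) - 4 * (10 + 24 * w)\<^sup>2)"
      unfolding Q_def \<beta>_def using w D
      by (simp add: divide_simps) (simp add: algebra_simps power2_eq_square)
    moreover have "0 \<le> \<dots>" using w quintuple_right_poly[of w] by simp
    ultimately show ?thesis by linarith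
  qed
  show ?thesis
  proof (rule real_zeros_disk_criterion[OF _ \<alpha> \<beta>, of _ "17 / 20"])
    fix s assume "s \<in> set [t, t, t, t, t]"
    thus "\<bar>s\<bar> < 1" using t by simp
  next
    \<comment> \<open>17/20 has fourth power 0.522 and is below cos (pi/6), the radius of the
      numerical range for t = 0.\<close>
    show "(1 / 2) powr (1 / (real (length [t, t, t, t, t]) - 1)) \<le> 17 / 20"
      using half_powr_le[of "17 / 20" 4] by (simp add: eval_nat_numeral)
  next
    have "1369 * (w * (5 - w))\<^sup>2 * (10 - w)\<^sup>2 / (90000 * (10 + 24 * w)\<^sup>2) \<le>
        9 * (225 - (w * (5 - w))\<^sup>2) * ((10 + 24 * w)\<^sup>2 - (10 - w)\<^sup>2) / (90000 * (10 + 24 * w)\<^sup>2)"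
      using quintuple_disk_poly[of w] w by (intro divide_right_mono) auto
    moreover have "(1 + 17 / 20)\<^sup>2 * (\<alpha>\<^sup>2 * \<beta>\<^sup>2) = 1369 * (w * (5 - w))\<^sup>2 * (10 - w)\<^sup>2 / (90000 * (10 + 24 * w)\<^sup>2)"
      by (simp add: \<alpha>_def \<beta>_def power_divide power2_eq_square)
    moreover have "(1 - 17 / 20)\<^sup>2 * ((1 - \<alpha>\<^sup>2) * (1 - \<beta>\<^sup>2)) =
        9 * (225 - (w * (5 - w))\<^sup>2) * ((10 + 24 * w)\<^sup>2 - (10 - w)\<^sup>2) / (90000 * (10 + 24 * w)\<^sup>2)"
    proof -
      have "1 - \<alpha>\<^sup>2 = (225 - (w * (5 - w))\<^sup>2) / 225" by (simp add: \<alpha>_def power_divide)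
      moreover have "1 - \<beta>\<^sup>2 = ((10 + 24 * w)\<^sup>2 - (10 - w)\<^sup>2) / (10 + 24 * w)\<^sup>2"
      proof -
        have "\<beta>\<^sup>2 = (10 - w)\<^sup>2 / (10 + 24 * w)\<^sup>2" by (simp add: \<beta>_def power_divide)
        thus ?thesis using D by (simp add: eq_divide_eq left_diff_distrib)
      qed
      moreover have "(1 - 17 / 20 :: real)\<^sup>2 = 9 / 400" by (simp add: power2_eq_square)
      moreover have "9 / 400 * (p / 225 * (q / e)) = 9 * p * q / (90000 * e)" for p q e :: real by simp
      ultimately show ?thesis by (simp only:)
    qed
    ultimately show "(1 + 17 / 20)\<^sup>2 * (\<alpha>\<^sup>2 * \<beta>\<^sup>2) \<le> (1 - 17 / 20)\<^sup>2 * ((1 - \<alpha>\<^sup>2) * (1 - \<beta>\<^sup>2))" by linarith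
  next
    fix v S d :: real
    assume v: "0 \<le> v" "v \<le> 1" and d: "0 < d" "d < pi" and S: "S = sin (d / 2)"
      "S\<^sup>2 = (1 - v) * \<alpha>\<^sup>2 + v * \<beta>\<^sup>2" "(1 - v) * \<alpha> + v * \<beta> \<le> S"
    have "(1 - v) * w + v * (1 / w) \<le> Q * S\<^sup>2 + 11 / 4 * S"
      by (rule convex_combination_bound[OF v S(2,3) _ left right]) simp
    hence "cot_numerator w v S \<le> 9 / 4 * S\<^sup>2 + 11 / 4 * S"
      by (simp add: cot_numerator_def Q_def algebra_simps)
    from cot_bound_quintuple[OF d S(1) this]
    have "5 * arctan (cot_numerator w v S / sin d) \<le> 5 * (pi / 2) - (pi - d)" .
    moreover have "((1 + t\<^sup>2) * (1 - 2 * S\<^sup>2) - 2 * t * (1 - 2 * v)) / ((1 - t\<^sup>2) * sin d) =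
        cot_numerator w v S / sin d"
      using t by (intro cot_numerator_eq) (auto simp: w_def)
    ultimately show "(\<Sum>s\<leftarrow>[t, t, t, t, t]. arctan (((1 + s\<^sup>2) * (1 - 2 * S\<^sup>2) - 2 * s * (1 - 2 * v)) / ((1 - s\<^sup>2) * sin d)))
        \<le> length [t, t, t, t, t] * (pi / 2) - (pi - d)"
      by simp
  qed simp_all
qed

section \<open>The product with a triple zero and its square root as simple zero\<close>

text \<open>Concavity replaces the four arctangents by their common tangent at k = cot x, where pi/2
  - x is the mean angle allowed. The bound on the numerators is then exact, since k sin d = 2 S (1 +
  S). The tangent bound is the reason for requiring \<open>c\<close> and \<open>c'\<close> to be
  nonnegative.\<close>

lemma cot_bound_mixed:
  assumes d: "0 < d" "d < pi" and S: "S = sin (d / 2)"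
    and "0 \<le> c" "0 \<le> c'" and c: "3 * c + c' \<le> 8 * S\<^sup>2 + 8 * S"
  shows "3 * arctan (c / sin d) + arctan (c' / sin d) \<le> 2 * pi - (pi - d)"
proof -
  define x where "x = (pi - d) / 4"
  define k where "k = cos x / sin x"
  have x: "0 < x" "x < pi / 4" using d by (simp_all add: x_def field_simps)
  have dx: "d = pi - 2 * (2 * x)" "d / 2 = pi / 2 - 2 * x" by (simp_all add: x_def field_simps)
  have Sx: "S = cos (2 * x)" unfolding S dx(2) by (simp add: sin_diff)
  have sin_d: "sin d = 4 * sin x * cos x * S"
    unfolding dx(1) Sx using sin_double[of "2 * x"] by (simp add: sin_diff sin_double)
  have pos: "sin d > 0" "sin x > 0" "cos x > 0" using d x by (simp_all add: sin_gt_zero cos_gt_zero)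
  have "2 * (cos x)\<^sup>2 = 1 + S" unfolding Sx cos_double_cos by simp
  moreover have "k * sin d = 2 * S * (2 * (cos x)\<^sup>2)"
    using pos by (simp add: k_def sin_d power2_eq_square)
  ultimately have "3 * c + c' \<le> 4 * (k * sin d)"
    using c by (simp add: power2_eq_square algebra_simps)
  hence "3 * (c / sin d) + c' / sin d \<le> 4 * k" using pos by (simp add: field_simps)
  hence "(3 * (c / sin d) + c' / sin d - 4 * k) / (1 + k\<^sup>2) \<le> 0"
    by (intro divide_nonpos_pos) (auto simp: add_pos_nonneg)
  moreover have "(3 * (c / sin d) + c' / sin d - 4 * k) / (1 + k\<^sup>2) =
      3 * ((c / sin d - k) / (1 + k\<^sup>2)) + (c' / sin d - k) / (1 + k\<^sup>2)"
    by (simp add: add_divide_distrib diff_divide_distrib)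
  moreover have "k \<ge> 0" using pos by (simp add: k_def)
  hence "arctan (c / sin d) \<le> arctan k + (c / sin d - k) / (1 + k\<^sup>2)"
    "arctan (c' / sin d) \<le> arctan k + (c' / sin d - k) / (1 + k\<^sup>2)"
    using assms(4,5) pos by (simp_all add: arctan_tangent_bound)
  ultimately have "3 * arctan (c / sin d) + arctan (c' / sin d) \<le> 4 * arctan k"
    by linarith
  also have "k = tan (pi / 2 - x)" by (simp add: k_def tan_def sin_diff cos_diff)
  also have "arctan \<dots> = pi / 2 - x" using x by (intro arctan_tan) (auto simp: field_simps)
  finally show ?thesis by (simp add: x_def field_simps)
qed

lemma mixed_zero_criterion:
  assumes t: "0 \<le> t" "t < 1"
  shows "pseudohyperbolic_disk_criterion (map of_real [t, t, t, sqrt t])"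
proof -
  define x where "x = (1 - sqrt t) / (1 + sqrt t)"
  define w where "w = (1 - t) / (1 + t)"
  have x: "0 < x" "x \<le> 1" using cayley_in_unit_interval[of "sqrt t"] t by (simp_all add: x_def)
  have xx: "x\<^sup>2 \<le> x" using x by (simp add: power2_eq_square mult_left_le)
  define u where "u = 1 + x\<^sup>2"
  have u: "u > 0" by (simp add: u_def add_pos_nonneg)
  \<comment> \<open>The Cayley transforms of \<open>t\<close> and its square root are related
    rationally, so the whole problem becomes rational in the single variable
    \<open>x\<close>.\<close>
  have w_eq: "w = 2 * x / u"
  proof -
    define q where "q = sqrt t"
    have q: "0 \<le> q" "t = q\<^sup>2" using t by (simp_all add: q_def)
    have "1 + q > 0" "1 + q\<^sup>2 > 0" using q by (auto simp: add_pos_nonneg)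
    moreover have "u = 2 * (1 + q\<^sup>2) / (1 + q)\<^sup>2"
    proof -
      have "u = 1 + (1 - q)\<^sup>2 / (1 + q)\<^sup>2"
        by (simp add: u_def x_def q_def[symmetric] power_divide)
      also have "\<dots> = ((1 + q)\<^sup>2 + (1 - q)\<^sup>2) / (1 + q)\<^sup>2"
        unfolding add_divide_distrib using \<open>1 + q > 0\<close> by simp
      also have "(1 + q)\<^sup>2 + (1 - q)\<^sup>2 = 2 * (1 + q\<^sup>2)" by (simp add: power2_eq_square algebra_simps)
      finally show ?thesis .
    qed
    moreover have "x = (1 - q) / (1 + q)" by (simp add: x_def q_def)
    ultimately have "2 * x / u = (1 - q) * (1 + q) / (1 + q\<^sup>2)"
      by (simp add: power2_eq_square del: distrib_left_numeral right_diff_distrib_numeral)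
    also have "\<dots> = w" by (simp add: w_def q(2) power2_eq_square algebra_simps)
    finally show ?thesis ..
  qed
  have w: "w > 0" "x \<le> w" "w \<le> 2 * x"
  proof -
    show "w > 0" using x u by (simp add: w_eq)
    have "x\<^sup>2 \<le> 1" using x by (simp add: power_le_one)
    hence "u \<le> 2" "1 \<le> u" by (simp_all add: u_def)
    thus "x \<le> w" "w \<le> 2 * x" using x u by (simp_all add: w_eq field_simps)
  qed
  define A where "A = 139 + 72 * x + 110 * x\<^sup>2"
  define B where "B = 10 + 32 * x + 2 * x\<^sup>2 - 13 * x ^ 3"
  define X where "X = 5 + 16 * x + 22 * x\<^sup>2 + 16 * x ^ 3 + 5 * x ^ 4"
  have A: "A \<ge> 139 + 72 * x" by (simp add: A_def)
  have B: "B \<ge> 10 + 19 * x"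
  proof -
    have "x ^ 3 \<le> x" using x power_decreasing[of 1 3 x] by simp
    thus ?thesis using zero_le_power2[of x] unfolding B_def by linarith
  qed
  \<comment> \<open>Upper bounds for the positive roots y of Q y^2 + 8 y = 3 w + x and Q y^2 + 8 y =
    3/w + 1/x. The coefficient 32 in \<open>B\<close> makes \<beta> correct to first order as
    \<open>x\<close> tends to 0, that is, as \<open>t\<close> tends to 1.\<close>
  define \<alpha> where "\<alpha> = 100 * x / A"
  define \<beta> where "\<beta> = 10 / B"
  have \<alpha>: "0 < \<alpha>" "\<alpha> < 1" using x A by (simp_all add: \<alpha>_def)
  have \<beta>: "0 < \<beta>" "\<beta> < 1" using x B by (simp_all add: \<beta>_def)
  have A0: "A > 0" and B0: "B > 0" using A B x by linarith+
  define Q where "Q = 3 * (w + 1 / w) + (x + 1 / x) + 8"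
  have Q: "Q = X / (2 * u * x)"
    unfolding Q_def w_eq using x u
    by (simp add: divide_simps) (simp add: u_def X_def algebra_simps eval_nat_numeral)
  have left: "3 * w + x \<le> Q * \<alpha>\<^sup>2 + 8 * \<alpha>"
  proof -
    have "3 * w + x = x * (14 + 2 * x\<^sup>2) / (2 * u)"
      unfolding w_eq using u by (simp add: divide_simps) (simp add: u_def algebra_simps power2_eq_square)
    also have "\<dots> = x * ((14 + 2 * x\<^sup>2) * A\<^sup>2) / (2 * u * A\<^sup>2)" using A0 by simp
    also have "\<dots> \<le> x * (10000 * X + 1600 * u * A) / (2 * u * A\<^sup>2)"
      using mixed_left_poly[of x] x u A0 unfolding A_def u_def X_def
      by (intro divide_right_mono mult_left_mono) auto
    also have "\<dots> = Q * \<alpha>\<^sup>2 + 8 * \<alpha>"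
      unfolding Q \<alpha>_def using x u A0 by (simp add: divide_simps) (simp add: algebra_simps power2_eq_square)
    finally show ?thesis .
  qed
  have right: "3 / w + 1 / x \<le> Q * \<beta>\<^sup>2 + 8 * \<beta>"
  proof -
    have "3 / w + 1 / x = u * (5 + 3 * x\<^sup>2) / (2 * u * x)"
      unfolding w_eq using u x by (simp add: divide_simps) (simp add: u_def algebra_simps power2_eq_square)
    also have "\<dots> = u * (5 + 3 * x\<^sup>2) * B\<^sup>2 / (2 * u * x * B\<^sup>2)" using B0 by simp
    also have "\<dots> \<le> (100 * X + 160 * x * u * B) / (2 * u * x * B\<^sup>2)"
      using mixed_right_poly[of x] x u B0 unfolding B_def u_def X_def
      by (intro divide_right_mono) auto
    also have "\<dots> = Q * \<beta>\<^sup>2 + 8 * \<beta>"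
      unfolding Q \<beta>_def using x u B0 by (simp add: divide_simps) (simp add: algebra_simps power2_eq_square)
    finally show ?thesis .
  qed
  \<comment> \<open>The two nonnegativity conditions read \<alpha>^2 <= y^2 / (1 + y^2), hardest for
    small y, and \<beta>^2 <= 1 / (1 + y^2), hardest for large y. They are needed for y = w and y =
    x, which both lie between x and 2 x.\<close>
  have left_nonneg: "(y + 1 / y) * \<alpha>\<^sup>2 \<le> y" if "x \<le> y" for y
  proof -
    have "10000 * (1 + x\<^sup>2) \<le> (139 + 72 * x)\<^sup>2"
      unfolding power2_sum using x xx by (simp add: power_mult_distrib)
    also have "\<dots> \<le> A\<^sup>2" using A x by (intro power_mono) auto
    finally have "10000 * (1 + x\<^sup>2) * x\<^sup>2 \<le> A\<^sup>2 * x\<^sup>2" by (intro mult_right_mono) auto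
    hence "\<alpha>\<^sup>2 \<le> x\<^sup>2 * (1 - \<alpha>\<^sup>2)"
      using A0 by (simp add: \<alpha>_def power_divide divide_simps) (simp add: algebra_simps)
    also have "\<dots> \<le> y\<^sup>2 * (1 - \<alpha>\<^sup>2)"
      using \<alpha> x that by (intro mult_right_mono power_mono) (auto simp: power_le_one)
    finally show ?thesis using x that by (simp add: field_simps power2_eq_square)
  qed
  have right_nonneg: "(y + 1 / y) * \<beta>\<^sup>2 \<le> 1 / y" if "0 < y" "y \<le> 2 * x" for y
  proof -
    have "y\<^sup>2 \<le> (2 * x)\<^sup>2" using that by (intro power_mono) auto
    hence "100 * (1 + y\<^sup>2) \<le> 100 + 400 * x\<^sup>2" by (simp add: power_mult_distrib)
    also have "\<dots> \<le> (10 + 19 * x)\<^sup>2"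
      unfolding power2_sum using x xx by (simp add: power_mult_distrib)
    also have "\<dots> \<le> B\<^sup>2" using B x by (intro power_mono) auto
    finally have "(1 + y\<^sup>2) * \<beta>\<^sup>2 \<le> 1" using B0 by (simp add: \<beta>_def power_divide divide_simps mult.commute)
    hence "(1 + y\<^sup>2) * \<beta>\<^sup>2 / y \<le> 1 / y" using that by (intro divide_right_mono) auto
    moreover have "(y + 1 / y) * \<beta>\<^sup>2 = (1 + y\<^sup>2) * \<beta>\<^sup>2 / y"
      using that by (simp add: field_simps power2_eq_square)
    ultimately show ?thesis by simp
  qed
  show ?thesis
  proof (rule real_zeros_disk_criterion[OF _ \<alpha> \<beta>, of _ "27 / 34"])
    fix s assume "s \<in> set [t, t, t, sqrt t]"
    thus "\<bar>s\<bar> < 1" using t by auto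
  next
    \<comment> \<open>27/34 has cube 0.5008, only just above 1/2, and is below cos (pi/5), the
      radius of the numerical range for t = 0.\<close>
    show "(1 / 2) powr (1 / (real (length [t, t, t, sqrt t]) - 1)) \<le> 27 / 34"
      using half_powr_le[of "27 / 34" 3] by (simp add: eval_nat_numeral)
  next
    have "3721000000 * x\<^sup>2 / (1156 * (A\<^sup>2 * B\<^sup>2)) \<le> 49 * (A\<^sup>2 - 10000 * x\<^sup>2) * (B\<^sup>2 - 100) / (1156 * (A\<^sup>2 * B\<^sup>2))"
      using mixed_disk_poly[of x] x unfolding A_def B_def by (intro divide_right_mono) auto
    moreover have "(1 + 27 / 34)\<^sup>2 * (\<alpha>\<^sup>2 * \<beta>\<^sup>2) = 3721000000 * x\<^sup>2 / (1156 * (A\<^sup>2 * B\<^sup>2))"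
      by (simp add: \<alpha>_def \<beta>_def power_divide power_mult_distrib power2_eq_square)
    moreover have "(1 - 27 / 34)\<^sup>2 * ((1 - \<alpha>\<^sup>2) * (1 - \<beta>\<^sup>2)) =
        49 * (A\<^sup>2 - 10000 * x\<^sup>2) * (B\<^sup>2 - 100) / (1156 * (A\<^sup>2 * B\<^sup>2))"
    proof -
      have "1 - \<alpha>\<^sup>2 = (A\<^sup>2 - 10000 * x\<^sup>2) / A\<^sup>2"
        using A0 by (simp add: \<alpha>_def power_divide power_mult_distrib diff_divide_distrib)
      moreover have "1 - \<beta>\<^sup>2 = (B\<^sup>2 - 100) / B\<^sup>2"
        using B0 by (simp add: \<beta>_def power_divide diff_divide_distrib)
      moreover have "(1 - 27 / 34 :: real)\<^sup>2 = 49 / 1156" by (simp add: power2_eq_square)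
      moreover have "49 / 1156 * (p / e * (q / e')) = 49 * p * q / (1156 * (e * e'))" for p q e e' :: real by simp
      ultimately show ?thesis by (simp only:)
    qed
    ultimately show "(1 + 27 / 34)\<^sup>2 * (\<alpha>\<^sup>2 * \<beta>\<^sup>2) \<le> (1 - 27 / 34)\<^sup>2 * ((1 - \<alpha>\<^sup>2) * (1 - \<beta>\<^sup>2))" by linarith
  next
    fix v S d :: real
    assume v: "0 \<le> v" "v \<le> 1" and d: "0 < d" "d < pi" and S: "S = sin (d / 2)"
      "S\<^sup>2 = (1 - v) * \<alpha>\<^sup>2 + v * \<beta>\<^sup>2" "(1 - v) * \<alpha> + v * \<beta> \<le> S"
    have "(1 - v) * (3 * w + x) + v * (3 / w + 1 / x) \<le> Q * S\<^sup>2 + 8 * S"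
      by (rule convex_combination_bound[OF v S(2,3) _ left right]) simp
    hence sum: "3 * cot_numerator w v S + cot_numerator x v S \<le> 8 * S\<^sup>2 + 8 * S"
      by (simp add: cot_numerator_def Q_def algebra_simps)
    have "0 \<le> cot_numerator w v S" "0 \<le> cot_numerator x v S"
      using cot_numerator_nonneg[OF v S(2)] left_nonneg right_nonneg w x by auto
    from cot_bound_mixed[OF d S(1) this sum]
    have "3 * arctan (cot_numerator w v S / sin d) + arctan (cot_numerator x v S / sin d) \<le> 2 * pi - (pi - d)" .
    moreover have "((1 + t\<^sup>2) * (1 - 2 * S\<^sup>2) - 2 * t * (1 - 2 * v)) / ((1 - t\<^sup>2) * sin d) =
        cot_numerator w v S / sin d"
      using t by (intro cot_numerator_eq) (auto simp: w_def)
    moreover have "((1 + (sqrt t)\<^sup>2) * (1 - 2 * S\<^sup>2) - 2 * sqrt t * (1 - 2 * v)) / ((1 - (sqrt t)\<^sup>2) * sin d) =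
        cot_numerator x v S / sin d"
      using t by (intro cot_numerator_eq) (auto simp: x_def)
    ultimately show "(\<Sum>s\<leftarrow>[t, t, t, sqrt t]. arctan (((1 + s\<^sup>2) * (1 - 2 * S\<^sup>2) - 2 * s * (1 - 2 * v)) / ((1 - s\<^sup>2) * sin d)))
        \<le> length [t, t, t, sqrt t] * (pi / 2) - (pi - d)"
      by (simp only: list.map sum_list.Cons sum_list.Nil) simp
  qed simp_all
qed

theorem theorem1p4:
  fixes t :: real and \<Theta> :: "complex \<Rightarrow> complex" and as :: "complex list"
  assumes "0 \<le> t" and "t < 1"
    and "(\<Theta> = (\<lambda>z. ((z - of_real t) / (1 - of_real t * z)) ^ 5) \<and>
          as = [of_real t, of_real t, of_real t, of_real t, of_real t]) \<or>
         (\<Theta> = (\<lambda>z. ((z - of_real t) / (1 - of_real t * z)) ^ 3 *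
                   ((z - of_real (sqrt t)) / (1 - of_real (sqrt t) * z))) \<and>
          as = [of_real t, of_real t, of_real t, of_real (sqrt t)])"
  shows "finite_blaschke_product \<Theta> as \<and> pseudohyperbolic_disk_criterion as"
  using assms(3)
proof (elim disjE conjE)
  assume \<Theta>: "\<Theta> = (\<lambda>z. ((z - of_real t) / (1 - of_real t * z)) ^ 5)"
    and as: "as = [of_real t, of_real t, of_real t, of_real t, of_real t]"
  have "finite_blaschke_product \<Theta> as"
    using assms(1,2) unfolding finite_blaschke_product_def \<Theta> as
    by (simp add: unit_disk_def eval_nat_numeral mult.assoc)
  thus ?thesis using quintuple_zero_criterion[OF assms(1,2)] by (simp add: as)
next
  assume \<Theta>: "\<Theta> = (\<lambda>z. ((z - of_real t) / (1 - of_real t * z)) ^ 3 *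
      ((z - of_real (sqrt t)) / (1 - of_real (sqrt t) * z)))"
    and as: "as = [of_real t, of_real t, of_real t, of_real (sqrt t)]"
  have "finite_blaschke_product \<Theta> as"
    using assms(1,2) unfolding finite_blaschke_product_def \<Theta> as
    by (simp add: unit_disk_def eval_nat_numeral mult.assoc)
  thus ?thesis using mixed_zero_criterion[OF assms(1,2)] by (simp add: as)
qed

end
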